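(* Let $\mathbf{P}$ be either the family $\mathbf{B}$ of probability distributions supported in $[0,1]$, or the family $\mathbf{H}$ of probability distributions $\kappa$ on $\mathbb{R}$ with $\mathbb{E}_\kappa[|X|^{1+\varepsilon}]\le\Gamma$ (for given known $\varepsilon>0$, $\Gamma>0$). Let $\nu\in\mathbf{P}$ have mean $m(\nu)=\mu$, let $\mathcal{C}$ be a cost distribution with mean $0<\overline c<\infty$, let the cost budget satisfy $C_\delta\to\infty$ as $\delta\to0$, and let $\pi\in\hat\Pi^s_{\rm CI}$ be any stable policy, with limiting endpoints $\mu_L^\pi(\nu)\le\mu\le\mu_R^\pi(\nu)$. Then: (a) (No learning regime) If $\lim_{\delta\to0}\frac{C_\delta}{\log(1/\delta)}=0$, then $\mu_R^\pi(\nu)-\mu_L^\pi(\nu)=\overline\mu-\underline\mu$. Further, $\widehat\mu_L^\pi(\tau_\delta,\delta)\overset{p}{\to}\underline\mu$ and $\widehat\mu_R^\pi(\tau_\delta,\delta)\overset{p}{\to}\overline\mu$ as $\delta\to0$. (b) (Sufficient learning regime) If $\lim_{\delta\to0}\frac{C_\delta}{\log(1/\delta)}=k$ with $k\in(0,\infty)$, then $$\mu_R^\pi(\nu)-\mu_L^\pi(\nu)\ \ge\ \mu_R^*(\nu,k,\overline c)-\mu_L^*(\nu,k,\overline c),$$ where $\mu_L^*(\nu,k,\overline c)<\mu$ and $\mu_R^*(\nu,k,\overline c)>\mu$ uniquely solve $$KL_{\rm inf}(\nu,\mathbf{P},\mu_R^*(\nu,k,\overline c))=KL_{\rm inf}(\nu,\mathbf{P},\mu_L^*(\nu,k,\overline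 c))=\frac{\overline c}{k}.$$
   Context: Mean ranges. $m(\kappa)$ denotes the mean of $\kappa$. $\underline\mu$ and $\overline\mu$ are the lower and upper ends of the range of means of the family: $\underline\mu=0$, $\overline\mu=1$ for $\mathbf{P}=\mathbf{B}$, and $\underline\mu=-\Gamma^{1/(1+\varepsilon)}$, $\overline\mu=\Gamma^{1/(1+\varepsilon)}$ for $\mathbf{P}=\mathbf{H}$. $KL_{\rm inf}$. For a family $\mathbf{P}$, $\nu\in\mathbf{P}$ and $x\in\mathbb{R}$: $KL_{\rm inf}(\nu,\mathbf{P},x)=\inf\{KL(\nu,\kappa):\kappa\in\mathbf{P},\,m(\kappa)\ge x\}$ if $x\ge m(\nu)$, and $KL_{\rm inf}(\nu,\mathbf{P},x)=\inf\{KL(\nu,\kappa):\kappa\in\mathbf{P},\,m(\kappa)\le x\}$ if $x<m(\nu)$, where $KL$ is the Kullback–Leibler divergence. Random costs. $X_1,X_2,\dots$ are i.i.d. from $\nu$; the costs $c_1,c_2,\dots$ are i.i.d. from an unknown distribution $\mathcal{C}$ with positive support and mean $\overline c$, independent of the $X_i$. For a budget $C_\delta$, $\tau_\delta=\sup\{n\in\mathbb{Z}^+:\sum_{i=1}^nc_i\le C_\delta\}$ (with $\tau_\delta=0$ if the set is empty). $\mathbb{P}_\nu$ denotes the joint law of samples and costs. Policies. A policy $\pi$ reports, for each $\delta\in(0,1)$, an interval $[\widehat\mu_L^\pi(\tau_\delta,\delta),\widehat\mu_R^\pi(\tau_\delta,\delta)]$ after observing $X_1,\dots,X_{\tau_\delta}$.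 $\hat\Pi_{\rm CI}$ is the set of policies such that for every $\nu\in\mathbf{P}$ and every $\delta\in(0,1)$, $\mathbb{P}_\nu(m(\nu)\in[\widehat\mu_L^\pi(\tau_\delta,\delta),\widehat\mu_R^\pi(\tau_\delta,\delta)])\ge1-\delta$. Stability. Let $C_\delta\to\infty$ as $\delta\to0$. For a given $\nu$ with mean $\mu$, a policy $\pi\in\hat\Pi_{\rm CI}$ is stable if, as $\delta\to0$, under $\mathbb{P}_\nu$, $\widehat\mu_L^\pi(\tau_\delta,\delta)\overset{p}{\to}\mu_L^\pi(\nu)$ and $\widehat\mu_R^\pi(\tau_\delta,\delta)\overset{p}{\to}\mu_R^\pi(\nu)$, where $\mu_L^\pi(\nu)\le\mu$ and $\mu_R^\pi(\nu)\ge\mu$ are constants ($\infty$ and $-\infty$ included). $\hat\Pi^s_{\rm CI}$ is the set of stable policies in $\hat\Pi_{\rm CI}$.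
   Formalization: Part (a) is stated for policies whose reported intervals lie in the range of means (the constant report [-5,5] for B refutes it otherwise); in (b) the left (right) solution is claimed only if the mean of ν is not the lower (upper) end of that range, where no solution exists. *)

theory Defs
  imports "HOL-Probability.Probability"
begin

abbreviation mean :: "real measure \<Rightarrow> real" where
  "mean \<kappa> \<equiv> (\<integral>x. x \<partial>\<kappa>)"

definition bounded_family :: "real measure set" where
  "bounded_family =
     {\<kappa>. prob_space \<kappa> \<and> sets \<kappa> = sets borel \<and> (AE x in \<kappa>. x \<in> {0..1})}"

(* The moment is a nonnegative integral, so that an infinite moment violates the bound. *)
definition moment_family :: "real \<Rightarrow> real \<Rightarrow> real measure set" where
  "moment_family \<epsilon> \<Gamma> =
     {\<kappa>. prob_space \<kappa> \<and> sets \<kappa> = sets borel \<and>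
          (\<integral>\<^sup>+x. ennreal (\<bar>x\<bar> powr (1 + \<epsilon>)) \<partial>\<kappa>) \<le> ennreal \<Gamma>}"

(* KL \<nu> \<kappa> = E_\<nu>[ln (d\<nu>/d\<kappa>)]; the library function takes the reference measure first and is
   real valued.  For probability measures the negative part of ln (d\<nu>/d\<kappa>) is always
   \<nu>-integrable, so failure of integrability means that the divergence is infinite. *)
definition KL :: "real measure \<Rightarrow> real measure \<Rightarrow> ereal" where
  "KL \<nu> \<kappa> =
     (if absolutely_continuous \<kappa> \<nu> \<and> integrable \<nu> (entropy_density (exp 1) \<kappa> \<nu>)
      then ereal (KL_divergence (exp 1) \<kappa> \<nu>) else \<infinity>)"

(* The infimum over the empty set is \<infinity>. *)
definition KL_inf :: "real measure \<Rightarrow> real measure set \<Rightarrow> real \<Rightarrow> ereal" where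
  "KL_inf \<nu> P x =
     (if mean \<nu> \<le> x then INF \<kappa>\<in>{\<kappa> \<in> P. x \<le> mean \<kappa>}. KL \<nu> \<kappa>
      else INF \<kappa>\<in>{\<kappa> \<in> P. mean \<kappa> \<le> x}. KL \<nu> \<kappa>)"

definition cost_distribution :: "real measure \<Rightarrow> bool" where
  "cost_distribution D \<longleftrightarrow>
     prob_space D \<and> sets D = sets borel \<and> (AE c in D. 0 < c) \<and> integrable D (\<lambda>c. c)"

(* An outcome is a pair (x, c) of sequences; the (i+1)-st sample is x i, its cost is c i. *)
definition joint_law :: "real measure \<Rightarrow> real measure \<Rightarrow> ((nat \<Rightarrow> real) \<times> (nat \<Rightarrow> real)) measure" where
  "joint_law \<nu> D = (\<Pi>\<^sub>M i\<in>UNIV. \<nu>) \<Otimes>\<^sub>M (\<Pi>\<^sub>M i\<in>UNIV. D)"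

(* Sup {} = 0 in nat.  The set is finite for almost every sequence of costs; on the
   remaining null set the value is immaterial. *)
definition stop_index :: "real \<Rightarrow> (nat \<Rightarrow> real) \<Rightarrow> nat" where
  "stop_index b c = Sup {n. 0 < n \<and> (\<Sum>i<n. c i) \<le> b}"

(* Endpoints as functions of the number n of samples, the level \<delta> and the
   samples themselves, which form a function on {..<n}. *)
record ci_policy =
  lower :: "nat \<Rightarrow> real \<Rightarrow> (nat \<Rightarrow> real) \<Rightarrow> ereal"
  upper :: "nat \<Rightarrow> real \<Rightarrow> (nat \<Rightarrow> real) \<Rightarrow> ereal"

definition reported ::
  "(nat \<Rightarrow> real \<Rightarrow> (nat \<Rightarrow> real) \<Rightarrow> ereal) \<Rightarrow> (real \<Rightarrow> real) \<Rightarrow> real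
     \<Rightarrow> (nat \<Rightarrow> real) \<times> (nat \<Rightarrow> real) \<Rightarrow> ereal" where
  "reported f C \<delta> \<omega> =
     (let n = stop_index (C \<delta>) (snd \<omega>) in f n \<delta> (restrict (fst \<omega>) {..<n}))"

definition valid_policies ::
  "real measure set \<Rightarrow> real measure \<Rightarrow> (real \<Rightarrow> real) \<Rightarrow> ci_policy set" where
  "valid_policies P D C =
     {\<pi>. (\<forall>n. \<forall>\<delta>\<in>{0<..<1}.
            lower \<pi> n \<delta> \<in> borel_measurable (\<Pi>\<^sub>M i\<in>{..<n}. borel) \<and>
            upper \<pi> n \<delta> \<in> borel_measurable (\<Pi>\<^sub>M i\<in>{..<n}. borel)) \<and>
         (\<forall>\<kappa>\<in>P. \<forall>\<delta>\<in>{0<..<1}.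
            measure (joint_law \<kappa> D)
              {\<omega> \<in> space (joint_law \<kappa> D).
                 ereal (mean \<kappa>) \<in> {reported (lower \<pi>) C \<delta> \<omega> .. reported (upper \<pi>) C \<delta> \<omega>}}
            \<ge> 1 - \<delta>)}"

(* Convergence in probability to a constant as \<delta> tends to 0 from above, in terms of
   neighbourhoods so that the constant may be infinite. *)
definition tendsto_in_prob :: "'a measure \<Rightarrow> (real \<Rightarrow> 'a \<Rightarrow> ereal) \<Rightarrow> ereal \<Rightarrow> bool" where
  "tendsto_in_prob M Y l \<longleftrightarrow>
     (\<forall>U. open U \<longrightarrow> l \<in> U \<longrightarrow>
        ((\<lambda>\<delta>. measure M {\<omega> \<in> space M. Y \<delta> \<omega> \<in> U}) \<longlongrightarrow> 1) (at_right 0))"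

definition stable_at ::
  "real measure \<Rightarrow> real measure \<Rightarrow> (real \<Rightarrow> real) \<Rightarrow> ci_policy \<Rightarrow> ereal \<Rightarrow> ereal \<Rightarrow> bool" where
  "stable_at \<nu> D C \<pi> mL mR \<longleftrightarrow>
     mL \<le> ereal (mean \<nu>) \<and> ereal (mean \<nu>) \<le> mR \<and>
     tendsto_in_prob (joint_law \<nu> D) (reported (lower \<pi>) C) mL \<and>
     tendsto_in_prob (joint_law \<nu> D) (reported (upper \<pi>) C) mR"

definition reports_within :: "ci_policy \<Rightarrow> real \<Rightarrow> real \<Rightarrow> bool" where
  "reports_within \<pi> lo hi \<longleftrightarrow>
     (\<forall>n. \<forall>\<delta>\<in>{0<..<1}. \<forall>x \<in> {..<n} \<rightarrow>\<^sub>E UNIV.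
        {lower \<pi> n \<delta> x .. upper \<pi> n \<delta> x} \<subseteq> {ereal lo .. ereal hi})"

end

theory Submission
  imports Defs
begin

text \<open>
  Let \<open>\<kappa>\<close> be another member of the family whose mean lies outside the interval between the limiting
  endpoints of the policy under \<open>\<nu>\<close>. Under \<open>\<nu>\<close> the event that an endpoint is reported near its limit has
  probability tending to 1; under \<open>\<kappa>\<close> it has probability at most \<open>\<delta>\<close>, since then the interval misses
  the mean of \<open>\<kappa>\<close>. To tell the two measures apart this well, a policy needs on average about
  \<open>ln (1 / \<delta>) / KL \<nu> \<kappa>\<close> samples, whereas the budget pays for about \<open>C \<delta> / cbar\<close> of them. If
  \<open>C \<delta> / ln (1 / \<delta>)\<close> tends to \<open>k\<close>, it follows that \<open>cbar \<le> k * KL \<nu> \<kappa>\<close>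
  (lemma \<open>information_budget\<close>).

  For \<open>k = 0\<close> no \<open>\<kappa>\<close> of finite divergence satisfies this. Mixtures of \<open>\<nu>\<close> with point masses at the ends
  of the range of means have finite divergence and reach every mean short of the ends; so the limits
  are the ends, since the reported intervals lie between them. For \<open>k > 0\<close> the means that can be
  excluded have divergence at least \<open>cbar / k\<close>, so the limits lie outside the interval between the two
  solutions of \<open>KL_inf = cbar / k\<close>.

  The lower bound on the number of samples is a statement about expectations. The inequality
  \<open>u \<le> exp u - 1\<close> gives a bound
  \<open>a * P\<^sub>\<nu>(A) \<le> n * KL \<nu> \<kappa> + (exp a - 1) * P\<^sub>\<kappa>(A)\<close> for events of \<open>n\<close> samples
  (lemmas \<open>change_of_measure\<close> and \<open>KL_sample_event_bound\<close>), which is linear in \<open>n\<close> and in the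
  probabilities. Averaging over the costs replaces \<open>n\<close> by the expected sample size, and Wald's identity
  for truncated costs bounds the latter by \<open>(C \<delta> + M) / E(min c M)\<close> (lemma \<open>expected_stop_index\<close>).

  Existence and uniqueness of the solutions rest on three facts about the least divergence as a function
  of the mean to be reached (locale \<open>extreme_mean\<close>). Mixing an alternative with \<open>\<nu>\<close> scales the
  divergence down, which gives strict monotonicity. Mixing it with the extreme point mass moves the mean
  outwards at a cost of \<open>- ln t\<close>, which gives continuity. Finally, a family member with nearly extreme mean
  concentrates at the extreme point, which makes the divergence from it unbounded.
\<close>

section \<open>A linear change-of-measure inequality\<close>

text \<open>
  Data processing in a linearised form. Integrating \<open>u \<le> exp u - 1\<close> against \<open>N\<close> for
  \<open>u = a * indicator A - S\<close> leaves the exponential moment of \<open>u\<close>; the factor \<open>exp (- S)\<close> cancels the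
  density \<open>G\<close>, so this moment is at most the \<open>M\<close>-integral of \<open>exp (a * indicator A)\<close>, which is
  \<open>1 + (exp a - 1) * M(A)\<close>. For \<open>S = ln G\<close> the integral of \<open>S\<close> is the divergence. Because the
  inequality is linear in both probabilities, it can later be averaged over a random sample size.
\<close>

lemma change_of_measure:
  fixes G S :: "'a \<Rightarrow> real" and a :: real
  assumes "prob_space M" "prob_space N"
    and N: "N = density M (\<lambda>x. ennreal (G x))"
    and G: "G \<in> borel_measurable M"
    and bound: "\<And>x. x \<in> space M \<Longrightarrow> G x * exp (- S x) \<le> 1"
    and S: "integrable N S" and A: "A \<in> sets M"
  shows "a * measure N A \<le> (\<integral>x. S x \<partial>N) + (exp a - 1) * measure M A"
proof -
  interpret M: prob_space M by fact
  interpret N: prob_space N by fact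
  have setsN [measurable_cong]: "sets N = sets M" by (simp add: N)
  note [measurable] = G A
  have S_meas [measurable]: "S \<in> borel_measurable M"
    using borel_measurable_integrable[OF S] by (simp add: N)
  define u where "u x = a * indicator A x - S x" for x
  have u [measurable]: "u \<in> borel_measurable M" unfolding u_def by measurable
  have iu: "integrable N u"
    unfolding u_def using S
    by (intro Bochner_Integration.integrable_diff) (auto simp: N.emeasure_eq_measure)
  define R where "R x = 1 + (exp a - 1) * indicator A x" for x :: 'a
  have R_eq: "R x = exp (a * indicator A x)" for x
    by (auto simp: R_def indicator_def)
  have iR: "integrable M R" unfolding R_def by (auto simp: M.emeasure_eq_measure)
  have int_R: "(\<integral>x. R x \<partial>M) = 1 + (exp a - 1) * measure M A"
    unfolding R_def using M.prob_space by (simp add: M.emeasure_eq_measure)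
  have "(\<integral>\<^sup>+x. ennreal (exp (u x)) \<partial>N) = (\<integral>\<^sup>+x. ennreal (G x) * ennreal (exp (u x)) \<partial>M)"
    unfolding N by (rule nn_integral_density) auto
  also have "\<dots> \<le> (\<integral>\<^sup>+x. ennreal (R x) \<partial>M)"
  proof (rule nn_integral_mono)
    fix x assume x: "x \<in> space M"
    show "ennreal (G x) * ennreal (exp (u x)) \<le> ennreal (R x)"
    proof (cases "0 \<le> G x")
      case True
      have "G x * exp (u x) = exp (a * indicator A x) * (G x * exp (- S x))"
        by (simp add: u_def exp_diff exp_minus field_simps)
      also have "\<dots> \<le> R x"
        using bound[OF x] by (simp add: R_eq mult_left_le)
      finally show ?thesis using True by (simp add: ennreal_leI flip: ennreal_mult')
    qed (simp add: ennreal_neg)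
  qed
  also have "\<dots> = ennreal (1 + (exp a - 1) * measure M A)"
    using iR by (subst nn_integral_eq_integral) (auto simp: int_R R_eq)
  finally have le: "(\<integral>\<^sup>+x. ennreal (exp (u x)) \<partial>N) \<le> ennreal (1 + (exp a - 1) * measure M A)" .
  have iexp: "integrable N (\<lambda>x. exp (u x))"
    using le by (intro integrableI_bounded) (auto intro: le_less_trans)
  have nn: "0 \<le> 1 + (exp a - 1) * measure M A"
    unfolding int_R[symmetric] by (rule integral_nonneg_AE) (simp add: R_eq)
  have "a * measure N A - (\<integral>x. S x \<partial>N) = (\<integral>x. u x \<partial>N)"
    unfolding u_def using S
    by (subst Bochner_Integration.integral_diff) (auto simp: N.emeasure_eq_measure)
  also have "\<dots> \<le> (\<integral>x. exp (u x) - 1 \<partial>N)"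
    using iu iexp by (intro integral_mono) (auto simp: algebra_simps exp_ge_add_one_self)
  also have "\<dots> = (\<integral>x. exp (u x) \<partial>N) - 1"
    using iexp N.prob_space by simp
  also have "(\<integral>x. exp (u x) \<partial>N) \<le> 1 + (exp a - 1) * measure M A"
    using le nn iexp by (subst (asm) nn_integral_eq_integral) auto
  finally show ?thesis by simp
qed

lemma PiM_density:
  fixes g :: "'a \<Rightarrow> real"
  assumes "prob_space M" "prob_space N" and N: "N = density M (\<lambda>x. ennreal (g x))"
    and g [measurable]: "g \<in> borel_measurable M" and nn: "\<And>x. 0 \<le> g x" and I: "finite I"
  shows "PiM I (\<lambda>_. N) = density (PiM I (\<lambda>_. M)) (\<lambda>x. ennreal (\<Prod>i\<in>I. g (x i)))"
proof -
  interpret M: prob_space M by fact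
  interpret N: prob_space N by fact
  interpret PN: product_sigma_finite "\<lambda>_. N" by standard
  interpret PM: product_sigma_finite "\<lambda>_. M" by standard
  have setsN: "sets N = sets M" by (simp add: N)
  show ?thesis
  proof (rule PN.PiM_eqI[OF I, symmetric])
    show "sets (density (PiM I (\<lambda>_. M)) (\<lambda>x. ennreal (\<Prod>i\<in>I. g (x i)))) = sets (PiM I (\<lambda>_. N))"
      by (simp add: setsN cong: sets_PiM_cong)
  next
    fix E assume E: "\<And>i. i \<in> I \<Longrightarrow> E i \<in> sets N"
    then have [measurable]: "i \<in> I \<Longrightarrow> E i \<in> sets M" for i by (simp add: setsN)
    have box [measurable]: "Pi\<^sub>E I E \<in> sets (PiM I (\<lambda>_. M))"
      using I by (intro sets_PiM_I_finite) auto
    have "emeasure (density (PiM I (\<lambda>_. M)) (\<lambda>x. ennreal (\<Prod>i\<in>I. g (x i)))) (Pi\<^sub>E I E)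
        = (\<integral>\<^sup>+x. ennreal (\<Prod>i\<in>I. g (x i)) * indicator (Pi\<^sub>E I E) x \<partial>PiM I (\<lambda>_. M))"
      by (rule emeasure_density) auto
    also have "\<dots> = (\<integral>\<^sup>+x. (\<Prod>i\<in>I. ennreal (g (x i)) * indicator (E i) (x i)) \<partial>PiM I (\<lambda>_. M))"
    proof (rule nn_integral_cong)
      fix x assume x: "x \<in> space (PiM I (\<lambda>_. M))"
      have "indicator (Pi\<^sub>E I E) x = (\<Prod>i\<in>I. indicator (E i) (x i) :: ennreal)"
        using I x by (auto simp: indicator_def space_PiM PiE_iff prod_zero_iff)
      then show "ennreal (\<Prod>i\<in>I. g (x i)) * indicator (Pi\<^sub>E I E) x
          = (\<Prod>i\<in>I. ennreal (g (x i)) * indicator (E i) (x i))"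
        using nn by (simp add: prod.distrib prod_ennreal)
    qed
    also have "\<dots> = (\<Prod>i\<in>I. \<integral>\<^sup>+x. ennreal (g x) * indicator (E i) x \<partial>M)"
      using I by (intro PM.product_nn_integral_prod) auto
    also have "\<dots> = (\<Prod>i\<in>I. emeasure N (E i))"
      unfolding N by (intro prod.cong refl emeasure_density[symmetric]) auto
    finally show "emeasure (density (PiM I (\<lambda>_. M)) (\<lambda>x. ennreal (\<Prod>i\<in>I. g (x i)))) (Pi\<^sub>E I E)
        = (\<Prod>i\<in>I. emeasure N (E i))" .
  qed
qed

lemma change_of_measure_product:
  fixes g :: "'a \<Rightarrow> real" and a :: real
  assumes "prob_space M" "prob_space N" and N: "N = density M (\<lambda>x. ennreal (g x))"
    and g [measurable]: "g \<in> borel_measurable M" and nn: "\<And>x. 0 \<le> g x"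
    and int: "integrable N (\<lambda>x. ln (g x))"
    and A: "A \<in> sets (PiM {..<n} (\<lambda>_. M))"
  shows "a * measure (PiM {..<n} (\<lambda>_. N)) A
    \<le> real n * (\<integral>x. ln (g x) \<partial>N) + (exp a - 1) * measure (PiM {..<n} (\<lambda>_. M)) A"
proof -
  interpret M: prob_space M by fact
  interpret N: prob_space N by fact
  let ?N = "PiM {..<n} (\<lambda>_. N)" and ?M = "PiM {..<n} (\<lambda>_. M)"
  have setsN [measurable_cong]: "sets N = sets M" by (simp add: N)
  have coord: "has_bochner_integral ?N (\<lambda>x. ln (g (x i))) (\<integral>x. ln (g x) \<partial>N)" if i: "i < n" for i
  proof -
    have d: "distr ?N N (\<lambda>x. x i) = N"
      using i by (intro distr_PiM_component) (auto intro: N.prob_space_axioms)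
    have comp: "(\<lambda>x. x i) \<in> measurable ?N N"
      using i by (intro measurable_component_singleton) auto
    have "integrable ?N (\<lambda>x. ln (g (x i)))"
      using int integrable_distr[OF comp, of "\<lambda>x. ln (g x)"] by (simp add: d)
    moreover have "(\<integral>x. ln (g (x i)) \<partial>?N) = (\<integral>x. ln (g x) \<partial>N)"
      using integral_distr[OF comp, of "\<lambda>x. ln (g x)"] by (simp add: d)
    ultimately show ?thesis by (simp add: has_bochner_integral_iff)
  qed
  have sum: "has_bochner_integral ?N (\<lambda>x. \<Sum>i<n. ln (g (x i))) (\<Sum>i<n. \<integral>x. ln (g x) \<partial>N)"
    by (rule has_bochner_integral_sum) (auto intro: coord)
  have "a * measure ?N A \<le> (\<integral>x. (\<Sum>i<n. ln (g (x i))) \<partial>?N) + (exp a - 1) * measure ?M A"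
  proof (rule change_of_measure)
    show "?N = density ?M (\<lambda>x. ennreal (\<Prod>i<n. g (x i)))"
      using assms by (intro PiM_density) auto
    show "(\<Prod>i<n. g (x i)) * exp (- (\<Sum>i<n. ln (g (x i)))) \<le> 1" for x
    proof (cases "\<exists>i<n. g (x i) = 0")
      case True
      then have "(\<Prod>i<n. g (x i)) = 0" by auto
      then show ?thesis by (simp only: mult_zero_left zero_le_one)
    next
      case False
      then have "\<And>i. i < n \<Longrightarrow> 0 < g (x i)" using nn by (metis less_eq_real_def)
      then have "exp (\<Sum>i<n. ln (g (x i))) = (\<Prod>i<n. g (x i))"
        by (simp add: exp_sum)
      then show ?thesis by (simp add: exp_minus field_simps)
    qed
    show "integrable ?N (\<lambda>x. \<Sum>i<n. ln (g (x i)))"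
      using sum by (auto simp: has_bochner_integral_iff)
  qed (use A in \<open>auto intro!: prob_space_PiM M.prob_space_axioms N.prob_space_axioms\<close>)
  then show ?thesis
    using sum by (simp add: has_bochner_integral_iff)
qed

text \<open>
  The definition of \<^const>\<open>KL\<close> speaks of the Radon-Nikodym derivative chosen by the library. This lemma
  and the next one replace it by an arbitrary real density, in both directions.
\<close>

lemma KL_finite_obtains_density:
  assumes "prob_space \<nu>" "prob_space \<kappa>" and sets: "sets \<nu> = sets \<kappa>"
    and KL: "KL \<nu> \<kappa> \<le> ereal c"
  obtains g where "g \<in> borel_measurable \<kappa>" "\<And>x. 0 \<le> g x" "\<nu> = density \<kappa> (\<lambda>x. ennreal (g x))"
    "integrable \<nu> (\<lambda>x. ln (g x))" "(\<integral>x. ln (g x) \<partial>\<nu>) \<le> c"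
proof -
  interpret K: prob_space \<kappa> by fact
  interpret V: prob_space \<nu> by fact
  have ac: "absolutely_continuous \<kappa> \<nu>" and int: "integrable \<nu> (entropy_density (exp 1) \<kappa> \<nu>)"
    and le: "KL_divergence (exp 1) \<kappa> \<nu> \<le> c"
    using KL by (auto simp: KL_def split: if_splits)
  have ed: "entropy_density (exp 1) \<kappa> \<nu> = (\<lambda>x. ln (enn2real (RN_deriv \<kappa> \<nu> x)))"
    by (auto simp: entropy_density_def log_def)
  have "AE x in \<kappa>. RN_deriv \<kappa> \<nu> x \<noteq> \<infinity>"
    using ac sets by (intro K.RN_deriv_finite) (auto intro: V.sigma_finite_measure_axioms)
  then have "density \<kappa> (\<lambda>x. ennreal (enn2real (RN_deriv \<kappa> \<nu> x))) = density \<kappa> (RN_deriv \<kappa> \<nu>)"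
    by (intro density_cong) (auto elim!: AE_mp simp: less_top)
  then have "\<nu> = density \<kappa> (\<lambda>x. ennreal (enn2real (RN_deriv \<kappa> \<nu> x)))"
    using K.density_RN_deriv[OF ac sets] by simp
  then show thesis
    using int le by (intro that[of "\<lambda>x. enn2real (RN_deriv \<kappa> \<nu> x)"])
      (auto simp: ed KL_divergence_def)
qed

text \<open>
  An integrable upper bound of the log-density suffices: its negative part is integrable anyway, since
  \<open>- ln h \<le> 1 / h\<close> and \<open>1 / h\<close> has \<open>\<nu>\<close>-integral at most 1.
\<close>

lemma KL_le_of_log_density_le:
  fixes h u :: "real \<Rightarrow> real"
  assumes "prob_space \<nu>" "prob_space \<kappa>"
    and h [measurable]: "h \<in> borel_measurable \<kappa>" and nn: "\<And>x. 0 \<le> h x"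
    and dens: "\<nu> = density \<kappa> (\<lambda>x. ennreal (h x))"
    and u: "integrable \<nu> u" and le: "AE x in \<nu>. ln (h x) \<le> u x" and c: "(\<integral>x. u x \<partial>\<nu>) \<le> c"
  shows "KL \<nu> \<kappa> \<le> ereal c"
proof -
  interpret K: prob_space \<kappa> by fact
  interpret V: prob_space \<nu> by fact
  have sets [measurable_cong]: "sets \<nu> = sets \<kappa>" by (simp add: dens)
  have ac: "absolutely_continuous \<kappa> \<nu>"
    unfolding dens by (rule absolutely_continuousI_density) measurable
  have pos: "AE x in \<nu>. 0 < h x"
    using nn unfolding dens by (subst AE_density) (auto simp: ennreal_eq_0_iff)
  have "(\<integral>\<^sup>+x. ennreal (1 / h x) \<partial>\<nu>) = (\<integral>\<^sup>+x. ennreal (h x) * ennreal (1 / h x) \<partial>\<kappa>)"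
    unfolding dens by (rule nn_integral_density) auto
  also have "\<dots> \<le> (\<integral>\<^sup>+x. 1 \<partial>\<kappa>)"
    using nn by (intro nn_integral_mono) (auto simp flip: ennreal_mult')
  also have "\<dots> = 1" using K.emeasure_space_1 by simp
  finally have inv: "integrable \<nu> (\<lambda>x. 1 / h x)"
    using nn by (intro integrableI_bounded) (auto intro: le_less_trans)
  have int: "integrable \<nu> (\<lambda>x. ln (h x))"
  proof (rule Bochner_Integration.integrable_bound)
    show "integrable \<nu> (\<lambda>x. \<bar>u x\<bar> + 1 / h x)"
      using u inv by (intro Bochner_Integration.integrable_add) auto
    show "AE x in \<nu>. norm (ln (h x)) \<le> norm (\<bar>u x\<bar> + 1 / h x)"
      using le pos
    proof eventually_elim
      case (elim x)
      have "- ln (h x) \<le> 1 / h x"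
        using ln_le_minus_one[of "1 / h x"] elim by (simp add: ln_div)
      moreover have "0 < 1 / h x" using elim by simp
      moreover have "u x \<le> \<bar>u x\<bar>" by simp
      ultimately show ?case using elim(1) unfolding real_norm_def by linarith
    qed
  qed measurable
  have RN: "AE x in \<nu>. entropy_density (exp 1) \<kappa> \<nu> x = ln (h x)"
  proof -
    have "AE x in \<kappa>. ennreal (h x) = RN_deriv \<kappa> \<nu> x"
      by (rule K.RN_deriv_unique) (auto simp: dens)
    then have "AE x in \<kappa>. entropy_density (exp 1) \<kappa> \<nu> x = ln (h x)"
      using nn by (auto elim!: AE_mp simp: entropy_density_def log_def dest!: sym[of "ennreal _"])
    then show ?thesis
      using ac by (intro absolutely_continuous_AE[of \<nu> \<kappa>]) (auto simp: sets)
  qed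
  have eint: "integrable \<nu> (entropy_density (exp 1) \<kappa> \<nu>)"
    using RN int by (subst integrable_cong_AE[where g="\<lambda>x. ln (h x)"]) auto
  have "KL_divergence (exp 1) \<kappa> \<nu> = (\<integral>x. ln (h x) \<partial>\<nu>)"
    unfolding KL_divergence_def using RN by (intro integral_cong_AE) auto
  also have "\<dots> \<le> c"
    using integral_mono_AE[OF int u le] c by simp
  finally show ?thesis
    using ac eint by (simp add: KL_def)
qed

lemma KL_set_bound:
  assumes "prob_space \<nu>" "prob_space \<kappa>" and sets: "sets \<nu> = sets \<kappa>"
    and KL: "KL \<nu> \<kappa> \<le> ereal c" and A: "A \<in> sets \<kappa>"
  shows "a * measure \<nu> A \<le> c + (exp a - 1) * measure \<kappa> A"
proof -
  obtain g where g: "g \<in> borel_measurable \<kappa>" "\<And>x. 0 \<le> g x" "\<nu> = density \<kappa> (\<lambda>x. ennreal (g x))"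
    "integrable \<nu> (\<lambda>x. ln (g x))" "(\<integral>x. ln (g x) \<partial>\<nu>) \<le> c"
    using KL_finite_obtains_density[OF assms(1-4)] by blast
  have "g x * exp (- ln (g x)) \<le> 1" for x
    using g(2)[of x] by (cases "g x = 0") (auto simp: exp_minus)
  then have "a * measure \<nu> A \<le> (\<integral>x. ln (g x) \<partial>\<nu>) + (exp a - 1) * measure \<kappa> A"
    by (intro change_of_measure[OF assms(2,1) g(3,1) _ g(4) A])
  then show ?thesis using g(5) by simp
qed

lemma KL_sample_event_bound:
  assumes "prob_space \<nu>" "prob_space \<kappa>" and sets: "sets \<nu> = sets \<kappa>"
    and KL: "KL \<nu> \<kappa> \<le> ereal c" and A: "A \<in> sets (PiM {..<n} (\<lambda>_. \<kappa>))"
  shows "a * measure (PiM {..<n} (\<lambda>_. \<nu>)) A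
    \<le> real n * c + (exp a - 1) * measure (PiM {..<n} (\<lambda>_. \<kappa>)) A"
proof -
  obtain g where g: "g \<in> borel_measurable \<kappa>" "\<And>x. 0 \<le> g x" "\<nu> = density \<kappa> (\<lambda>x. ennreal (g x))"
    "integrable \<nu> (\<lambda>x. ln (g x))" "(\<integral>x. ln (g x) \<partial>\<nu>) \<le> c"
    using KL_finite_obtains_density[OF assms(1-4)] by blast
  have "a * measure (PiM {..<n} (\<lambda>_. \<nu>)) A
    \<le> real n * (\<integral>x. ln (g x) \<partial>\<nu>) + (exp a - 1) * measure (PiM {..<n} (\<lambda>_. \<kappa>)) A"
    by (rule change_of_measure_product[OF assms(2,1) g(3,1,2,4) A])
  also have "real n * (\<integral>x. ln (g x) \<partial>\<nu>) \<le> real n * c"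
    using g(5) by (intro mult_left_mono) auto
  finally show ?thesis by simp
qed

section \<open>The number of samples that a budget affords\<close>

text \<open>
  The costs that are incurred while the budget is not yet exceeded add up to at most the budget and one
  last, overshooting cost. Truncation at \<open>M\<close> bounds the overshoot. The minimum on the right makes the
  induction work.
\<close>

lemma sum_truncated_until_exceeding:
  fixes c :: "nat \<Rightarrow> real"
  assumes c: "\<And>i. 0 \<le> c i" and M: "0 \<le> M" and b: "0 \<le> b"
  shows "(\<Sum>n<K. if (\<Sum>i<n. c i) \<le> b then min (c n) M else 0) \<le> min (\<Sum>i<K. c i) (b + M)"
proof (induction K)
  case (Suc K)
  then show ?case using c[of K] M by (auto simp: min_def split: if_splits)
qed (use M b in auto)

text \<open>
  Partial sums of nonnegative costs increase. The claim also covers an infinite set of affordable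
  sample sizes, where the supremum in \<^typ>\<open>nat\<close> is a default value: then every sample size is
  affordable.
\<close>

lemma partial_sums_before_stop_index:
  fixes c :: "nat \<Rightarrow> real"
  assumes c: "\<And>i. 0 \<le> c i" and n: "n < stop_index b c"
  shows "(\<Sum>i<n. c i) \<le> b"
proof -
  let ?J = "{n. 0 < n \<and> (\<Sum>i<n. c i) \<le> b}"
  have "\<exists>m\<in>?J. n < m"
  proof (cases "finite ?J")
    case True
    moreover have "?J \<noteq> {}"
    proof
      assume "?J = {}"
      then have "stop_index b c = 0" by (simp only: stop_index_def Sup_nat_empty)
      then show False using n by simp
    qed
    ultimately have "stop_index b c \<in> ?J"
      unfolding stop_index_def Sup_nat_def using Max_in[of ?J] by auto
    then show ?thesis using n by blast
  next
    case False
    then show ?thesis unfolding infinite_nat_iff_unbounded by blast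
  qed
  then obtain m where m: "n < m" "(\<Sum>i<m. c i) \<le> b" by auto
  have "(\<Sum>i<n. c i) \<le> (\<Sum>i<m. c i)"
    using m(1) c by (intro sum_mono2) auto
  then show ?thesis using m by simp
qed

lemma truncated_cost_mean_pos:
  assumes "cost_distribution D" "0 < M"
  shows "0 < (\<integral>x. min x M \<partial>D)" "integrable D (\<lambda>x. min x M)"
proof -
  interpret D: prob_space D using assms by (simp add: cost_distribution_def)
  have [measurable_cong]: "sets D = sets borel" and pos: "AE c in D. 0 < c" and int: "integrable D (\<lambda>c. c)"
    using assms by (auto simp: cost_distribution_def)
  show i: "integrable D (\<lambda>x. min x M)"
    using int by (rule Bochner_Integration.integrable_bound) (use pos \<open>0 < M\<close> in \<open>auto elim!: AE_mp\<close>)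
  have nn: "AE x in D. 0 \<le> min x M" using pos \<open>0 < M\<close> by (auto elim!: AE_mp)
  have "(\<integral>x. min x M \<partial>D) \<noteq> 0"
  proof
    assume "(\<integral>x. min x M \<partial>D) = 0"
    then have "AE x in D. min x M = 0"
      using integral_nonneg_eq_0_iff_AE[OF i nn] by simp
    then have "AE x in D. False"
      using pos by eventually_elim (use \<open>0 < M\<close> in \<open>auto simp: min_def split: if_splits\<close>)
    then show False by simp
  qed
  then show "0 < (\<integral>x. min x M \<partial>D)"
    using integral_nonneg_AE[OF nn] by simp
qed

text \<open>
  Independence of coordinate \<open>n\<close> from the earlier ones. Replacing the coordinates from \<open>n\<close> on by
  those of a second, independent sequence does not change the law of the sequence; afterwards the two
  factors live on different components of a product space.
\<close>

lemma (in sequence_space) nn_integral_past_times_present: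
  assumes F: "F \<in> borel_measurable S" and f: "f \<in> borel_measurable M"
    and past: "\<And>\<omega> \<omega>'. (\<And>i. i < n \<Longrightarrow> \<omega> i = \<omega>' i) \<Longrightarrow> F \<omega> = F \<omega>'"
  shows "(\<integral>\<^sup>+\<omega>. F \<omega> * f (\<omega> n) \<partial>S) = (\<integral>\<^sup>+\<omega>. F \<omega> \<partial>S) * (\<integral>\<^sup>+x. f x \<partial>M)"
proof -
  note [measurable] = F f
  have comb [measurable]: "(\<lambda>(\<omega>, \<omega>'). comb_seq n \<omega> \<omega>') \<in> measurable (S \<Otimes>\<^sub>M S) S"
    by (rule measurable_comb_seq)
  have "(\<integral>\<^sup>+\<omega>. F \<omega> * f (\<omega> n) \<partial>S)
      = (\<integral>\<^sup>+\<omega>. F \<omega> * f (\<omega> n) \<partial>distr (S \<Otimes>\<^sub>M S) S (\<lambda>(\<omega>, \<omega>'). comb_seq n \<omega> \<omega>'))"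
    by (simp only: PiM_comb_seq)
  also have "\<dots> = (\<integral>\<^sup>+z. F (fst z) * f (snd z 0) \<partial>(S \<Otimes>\<^sub>M S))"
  proof (subst nn_integral_distr[OF comb], measurable, intro nn_integral_cong)
    fix z :: "(nat \<Rightarrow> 'a) \<times> (nat \<Rightarrow> 'a)"
    have "F (comb_seq n (fst z) (snd z)) = F (fst z)"
      by (rule past) (simp add: comb_seq_less)
    moreover have "comb_seq n (fst z) (snd z) n = snd z 0"
      using comb_seq_add[of n "fst z" "snd z" 0] by simp
    ultimately show "F (case z of (\<omega>, \<omega>') \<Rightarrow> comb_seq n \<omega> \<omega>')
        * f ((case z of (\<omega>, \<omega>') \<Rightarrow> comb_seq n \<omega> \<omega>') n) = F (fst z) * f (snd z 0)"
      by (simp add: case_prod_beta)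
  qed
  also have "\<dots> = (\<integral>\<^sup>+\<omega>. \<integral>\<^sup>+\<omega>'. F \<omega> * f (\<omega>' 0) \<partial>S \<partial>S)"
    by (subst P.nn_integral_fst[symmetric]) auto
  also have "\<dots> = (\<integral>\<^sup>+\<omega>. F \<omega> * (\<integral>\<^sup>+x. f x \<partial>distr S M (\<lambda>\<omega>. \<omega> 0)) \<partial>S)"
    by (simp add: nn_integral_cmult nn_integral_distr)
  also have "\<dots> = (\<integral>\<^sup>+\<omega>. F \<omega> \<partial>S) * (\<integral>\<^sup>+x. f x \<partial>M)"
    by (simp add: PiM_component nn_integral_multc)
  finally show ?thesis .
qed

lemma measurable_stop_index:
  assumes [measurable_cong]: "sets D = sets borel"
  shows "stop_index b \<in> measurable (\<Pi>\<^sub>M i\<in>UNIV. D) (count_space UNIV)"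
proof -
  have "(\<lambda>c. Sup {n::nat. 0 < n \<and> (\<Sum>i<n. c i) \<le> b}) \<in> measurable (\<Pi>\<^sub>M i\<in>UNIV. D) (count_space UNIV)"
  proof (rule measurable_Sup_nat)
    show "Measurable.pred (\<Pi>\<^sub>M i\<in>UNIV. D) (\<lambda>c. n \<in> {n::nat. 0 < n \<and> (\<Sum>i<n. c i) \<le> b})" for n
      unfolding mem_Collect_eq by measurable
  qed
  then show ?thesis by (simp add: stop_index_def[abs_def])
qed

text \<open>
  Wald's identity for the truncated costs: the cost of step \<open>n\<close> is independent of the event that the
  budget is not exceeded by the first \<open>n\<close> costs. Hence the mean truncated cost times the expected
  number of such \<open>n\<close> is the expected truncated expenditure, at most \<open>b + M\<close>. As \<open>M\<close> is arbitrary,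
  this is asymptotically the bound \<open>b / mean D\<close>.
\<close>

lemma expected_stop_index:
  assumes D: "cost_distribution D" and M: "0 < M" and b: "0 \<le> b"
  shows "integrable (\<Pi>\<^sub>M i\<in>UNIV. D) (\<lambda>c. real (stop_index b c))"
    and "(\<integral>c. real (stop_index b c) \<partial>(\<Pi>\<^sub>M i\<in>UNIV. D)) \<le> (b + M) / (\<integral>x. min x M \<partial>D)"
proof -
  interpret D: prob_space D using D by (simp add: cost_distribution_def)
  interpret sequence_space D by standard
  have sets [measurable_cong]: "sets D = sets borel" and pos: "AE c in D. 0 < c"
    using D by (auto simp: cost_distribution_def)
  note d = truncated_cost_mean_pos[OF D M]
  note [measurable] = measurable_stop_index[OF sets]
  let ?d = "\<integral>x. min x M \<partial>D"
  let ?Z = "\<lambda>n c. indicator {c. (\<Sum>i<n. c i) \<le> b} c :: ennreal"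
  have Z [measurable]: "?Z n \<in> borel_measurable S" for n
    by measurable
  have pos_seq: "AE c in S. \<forall>i. 0 < c i"
    using pos by (subst AE_all_countable) (auto intro!: AE_PiM_component D.prob_space_axioms)
  have nn_d: "(\<integral>\<^sup>+x. ennreal (min x M) \<partial>D) = ennreal ?d"
    using pos M by (intro nn_integral_eq_integral d) (auto elim!: AE_mp)
  have wald: "(\<integral>\<^sup>+c. ?Z n c \<partial>S) * ennreal ?d = (\<integral>\<^sup>+c. ?Z n c * ennreal (min (c n) M) \<partial>S)" for n
    unfolding nn_d[symmetric]
  proof (rule nn_integral_past_times_present[symmetric])
    show "?Z n \<omega> = ?Z n \<omega>'" if "\<And>i. i < n \<Longrightarrow> \<omega> i = \<omega>' i" for \<omega> \<omega>' :: "nat \<Rightarrow> real"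
    proof -
      have "(\<Sum>i<n. \<omega> i) = (\<Sum>i<n. \<omega>' i)" using that by (intro sum.cong) auto
      then show ?thesis by (simp add: indicator_def)
    qed
  qed measurable
  have path: "(\<Sum>n. ?Z n c * ennreal (min (c n) M)) \<le> ennreal (b + M)" if c: "\<And>i. 0 < c i" for c
  proof (rule suminf_le_const)
    fix K
    have "(\<Sum>n<K. ?Z n c * ennreal (min (c n) M))
        = (\<Sum>n<K. ennreal (if (\<Sum>i<n. c i) \<le> b then min (c n) M else 0))"
      by (intro sum.cong) (auto simp: indicator_def)
    also have "\<dots> = ennreal (\<Sum>n<K. if (\<Sum>i<n. c i) \<le> b then min (c n) M else 0)"
      using c M by (intro sum_ennreal) (auto simp: less_imp_le)
    also have "\<dots> \<le> ennreal (b + M)"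
      using sum_truncated_until_exceeding[of c M b K] c M b by (intro ennreal_leI) (auto simp: less_imp_le)
    finally show "(\<Sum>n<K. ?Z n c * ennreal (min (c n) M)) \<le> ennreal (b + M)" .
  qed auto
  have count: "ennreal (real (stop_index b c)) \<le> (\<Sum>n. ?Z n c)" if c: "\<And>i. 0 < c i" for c
  proof -
    have "ennreal (real (stop_index b c)) = (\<Sum>n<stop_index b c. 1)"
      by (simp add: ennreal_of_nat_eq_real_of_nat)
    also have "\<dots> = (\<Sum>n<stop_index b c. ?Z n c)"
      using partial_sums_before_stop_index[of c _ b] c
      by (intro sum.cong) (auto simp: indicator_def less_imp_le)
    also have "\<dots> \<le> (\<Sum>n. ?Z n c)"
      by (intro sum_le_suminf) auto
    finally show ?thesis .
  qed
  have "(\<integral>\<^sup>+c. ennreal (real (stop_index b c)) \<partial>S) * ennreal ?d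
      \<le> (\<integral>\<^sup>+c. (\<Sum>n. ?Z n c) \<partial>S) * ennreal ?d"
    using pos_seq count by (intro mult_right_mono nn_integral_mono_AE) (auto elim!: AE_mp)
  also have "\<dots> = (\<Sum>n. (\<integral>\<^sup>+c. ?Z n c \<partial>S) * ennreal ?d)"
    by (subst nn_integral_suminf) (auto simp: ennreal_suminf_multc)
  also have "\<dots> = (\<integral>\<^sup>+c. (\<Sum>n. ?Z n c * ennreal (min (c n) M)) \<partial>S)"
    by (subst nn_integral_suminf) (auto simp: wald)
  also have "\<dots> \<le> (\<integral>\<^sup>+c. ennreal (b + M) \<partial>S)"
    using pos_seq path by (intro nn_integral_mono_AE) (auto elim!: AE_mp)
  also have "\<dots> = ennreal (b + M)"
    using P.emeasure_space_1 by simp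
  also have "\<dots> = ennreal ((b + M) / ?d) * ennreal ?d"
    using d(1) b M by (simp flip: ennreal_mult')
  finally have le: "(\<integral>\<^sup>+c. ennreal (real (stop_index b c)) \<partial>S) \<le> ennreal ((b + M) / ?d)"
    using d(1) by (simp add: ennreal_mult_le_mult_iff mult.commute)
  show int: "integrable S (\<lambda>c. real (stop_index b c))"
    using le by (intro integrableI_bounded) (auto intro: le_less_trans)
  show "(\<integral>c. real (stop_index b c) \<partial>S) \<le> (b + M) / ?d"
    using le int d(1) b M by (subst (asm) nn_integral_eq_integral) auto
qed

section \<open>What a valid policy must spend to exclude an alternative\<close>

text \<open>
  Given the costs, the sample size is a constant and the reported endpoint is a function of a fixed
  number of samples. So the probability of an event is an average of probabilities under finite
  products.
\<close>

lemma reported_event: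
  assumes "prob_space \<kappa>" and sets: "sets \<kappa> = sets borel" and D: "cost_distribution D"
    and f: "\<And>n. f n \<delta> \<in> borel_measurable (\<Pi>\<^sub>M i\<in>{..<n}. borel)" and U: "U \<in> sets borel"
  shows "{\<omega> \<in> space (joint_law \<kappa> D). reported f C \<delta> \<omega> \<in> U} \<in> sets (joint_law \<kappa> D)" (is "?E \<in> _")
    and "measure (joint_law \<kappa> D) {\<omega> \<in> space (joint_law \<kappa> D). reported f C \<delta> \<omega> \<in> U}
      = (\<integral>c. measure (\<Pi>\<^sub>M i\<in>{..<stop_index (C \<delta>) c}. \<kappa>)
               {x \<in> space (\<Pi>\<^sub>M i\<in>{..<stop_index (C \<delta>) c}. borel). f (stop_index (C \<delta>) c) \<delta> x \<in> U}
          \<partial>(\<Pi>\<^sub>M i\<in>UNIV. D))"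
proof -
  interpret K: prob_space \<kappa> by fact
  interpret D: prob_space D using D by (simp add: cost_distribution_def)
  interpret KS: product_prob_space "\<lambda>_. \<kappa>" "UNIV :: nat set" by standard
  interpret DS: product_prob_space "\<lambda>_. D" "UNIV :: nat set" by standard
  let ?X = "\<Pi>\<^sub>M i\<in>(UNIV::nat set). \<kappa>" and ?Y = "\<Pi>\<^sub>M i\<in>(UNIV::nat set). D"
  interpret XY: pair_prob_space ?X ?Y by standard
  note [measurable_cong] = sets
  have setsD [measurable_cong]: "sets D = sets borel" using D by (simp add: cost_distribution_def)
  note [measurable] = measurable_stop_index[OF setsD] U
  have sp: "space \<kappa> = UNIV" using sets_eq_imp_space_eq[OF sets] by simp
  define B where "B n = {x \<in> space (\<Pi>\<^sub>M i\<in>{..<n}. borel). f n \<delta> x \<in> U}" for n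
  have B [measurable]: "B n \<in> sets (\<Pi>\<^sub>M i\<in>{..<n}. borel)" for n
    using measurable_sets[OF f[of n] U] by (simp add: B_def vimage_def Int_def conj_commute)
  have setsPi: "sets (\<Pi>\<^sub>M i\<in>{..<n}. \<kappa>) = sets (\<Pi>\<^sub>M i\<in>{..<n}. borel)" for n
    by (intro sets_PiM_cong) (auto simp: sets)
  let ?N = "stop_index (C \<delta>)"
  have rep: "reported f C \<delta> (x, c) \<in> U \<longleftrightarrow> restrict x {..<?N c} \<in> B (?N c)" for x c
    by (simp add: reported_def Let_def B_def space_PiM)
  have slice [measurable]: "{x \<in> space ?X. restrict x {..<n} \<in> B n} \<in> sets ?X" for n
    by measurable
  have Esets: "?E \<in> sets (?X \<Otimes>\<^sub>M ?Y)"
  proof -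
    have "?E = (\<Union>n. {x \<in> space ?X. restrict x {..<n} \<in> B n} \<times> {c \<in> space ?Y. ?N c = n})"
      by (auto simp: joint_law_def space_pair_measure rep)
    also have "\<dots> \<in> sets (?X \<Otimes>\<^sub>M ?Y)" by measurable
    finally show ?thesis .
  qed
  then show "?E \<in> sets (joint_law \<kappa> D)" by (simp add: joint_law_def)
  define p where "p n = measure (\<Pi>\<^sub>M i\<in>{..<n}. \<kappa>) (B n)" for n
  have p: "emeasure ?X {x \<in> space ?X. restrict x {..<n} \<in> B n} = ennreal (p n)" for n
  proof -
    interpret PN: prob_space "\<Pi>\<^sub>M i\<in>{..<n}. \<kappa>"
      by (intro prob_space_PiM K.prob_space_axioms)
    have "emeasure (\<Pi>\<^sub>M i\<in>{..<n}. \<kappa>) (B n)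
        = emeasure (distr ?X (\<Pi>\<^sub>M i\<in>{..<n}. \<kappa>) (\<lambda>x. restrict x {..<n})) (B n)"
      by (subst KS.distr_PiM_restrict_finite) auto
    also have "\<dots> = emeasure ?X ((\<lambda>x. restrict x {..<n}) -` B n \<inter> space ?X)"
      using B[of n] by (intro emeasure_distr) (auto simp: setsPi)
    also have "(\<lambda>x. restrict x {..<n}) -` B n \<inter> space ?X = {x \<in> space ?X. restrict x {..<n} \<in> B n}"
      by auto
    finally show ?thesis by (simp add: p_def PN.emeasure_eq_measure)
  qed
  have "emeasure (?X \<Otimes>\<^sub>M ?Y) ?E = (\<integral>\<^sup>+c. emeasure ?X ((\<lambda>x. (x, c)) -` ?E) \<partial>?Y)"
    using Esets by (rule XY.emeasure_pair_measure_alt2)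
  also have "\<dots> = (\<integral>\<^sup>+c. ennreal (p (?N c)) \<partial>?Y)"
  proof (rule nn_integral_cong)
    fix c assume c: "c \<in> space ?Y"
    have "(\<lambda>x. (x, c)) -` ?E = {x \<in> space ?X. restrict x {..<?N c} \<in> B (?N c)}"
      using c by (auto simp: joint_law_def space_pair_measure rep)
    then show "emeasure ?X ((\<lambda>x. (x, c)) -` ?E) = ennreal (p (?N c))" by (simp add: p)
  qed
  also have "\<dots> = ennreal (\<integral>c. p (?N c) \<partial>?Y)"
  proof (rule nn_integral_eq_integral)
    show "integrable ?Y (\<lambda>c. p (?N c))"
    proof (rule DS.P.integrable_const_bound[where B=1])
      show "AE c in ?Y. norm (p (?N c)) \<le> 1"
        by (auto simp: p_def intro!: prob_space.prob_le_1 prob_space_PiM K.prob_space_axioms)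
    qed measurable
  qed (simp add: p_def)
  finally show "measure (joint_law \<kappa> D) ?E = (\<integral>c. measure (\<Pi>\<^sub>M i\<in>{..<?N c}. \<kappa>)
      {x \<in> space (\<Pi>\<^sub>M i\<in>{..<?N c}. borel). f (?N c) \<delta> x \<in> U} \<partial>?Y)"
    by (simp add: joint_law_def measure_def p_def B_def integral_nonneg_AE)
qed

lemma KL_bound_nonneg:
  assumes "prob_space \<nu>" "prob_space \<kappa>" "sets \<nu> = sets \<kappa>" "KL \<nu> \<kappa> \<le> ereal c"
  shows "0 \<le> c"
proof -
  have "0 * measure (\<Pi>\<^sub>M i\<in>{..<1::nat}. \<nu>) {}
      \<le> real 1 * c + (exp 0 - 1) * measure (\<Pi>\<^sub>M i\<in>{..<1::nat}. \<kappa>) {}"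
    by (rule KL_sample_event_bound[OF assms]) (rule sets.empty_sets)
  then show ?thesis by simp
qed

text \<open>
  The bound for a fixed sample size is averaged over the costs, which have the same law under \<open>\<nu>\<close>
  and \<open>\<kappa>\<close> and so carry no information.
\<close>

lemma change_of_measure_reported:
  assumes "prob_space \<nu>" "prob_space \<kappa>" and s\<nu>: "sets \<nu> = sets borel" and s\<kappa>: "sets \<kappa> = sets borel"
    and KL: "KL \<nu> \<kappa> \<le> ereal c" and D: "cost_distribution D"
    and f: "\<And>n. f n \<delta> \<in> borel_measurable (\<Pi>\<^sub>M i\<in>{..<n}. borel)" and U: "U \<in> sets borel"
    and M: "0 < M" and b: "0 \<le> C \<delta>"
  shows "a * measure (joint_law \<nu> D) {\<omega> \<in> space (joint_law \<nu> D). reported f C \<delta> \<omega> \<in> U}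
    \<le> (C \<delta> + M) / (\<integral>x. min x M \<partial>D) * c
      + (exp a - 1) * measure (joint_law \<kappa> D) {\<omega> \<in> space (joint_law \<kappa> D). reported f C \<delta> \<omega> \<in> U}"
proof -
  interpret K: prob_space \<kappa> by fact
  interpret V: prob_space \<nu> by fact
  interpret D: prob_space D using D by (simp add: cost_distribution_def)
  let ?Y = "\<Pi>\<^sub>M i\<in>(UNIV::nat set). D" and ?N = "stop_index (C \<delta>)"
  interpret Y: prob_space ?Y by (intro prob_space_PiM D.prob_space_axioms)
  have setsD [measurable_cong]: "sets D = sets borel" using D by (simp add: cost_distribution_def)
  note [measurable] = measurable_stop_index[OF setsD]
  define B where "B n = {x \<in> space (\<Pi>\<^sub>M i\<in>{..<n}. borel). f n \<delta> x \<in> U}" for n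
  have setsPi: "sets (\<Pi>\<^sub>M i\<in>{..<n}. \<kappa>) = sets (\<Pi>\<^sub>M i\<in>{..<n}. borel)" for n
    by (intro sets_PiM_cong) (auto simp: s\<kappa>)
  have B: "B n \<in> sets (\<Pi>\<^sub>M i\<in>{..<n}. \<kappa>)" for n
    unfolding B_def setsPi using f[of n] U by measurable
  define p where "p n = measure (\<Pi>\<^sub>M i\<in>{..<n}. \<nu>) (B n)" for n
  define q where "q n = measure (\<Pi>\<^sub>M i\<in>{..<n}. \<kappa>) (B n)" for n
  have pi: "integrable ?Y (\<lambda>c. p (?N c))"
  proof (rule Y.integrable_const_bound[where B=1])
    show "AE c in ?Y. norm (p (?N c)) \<le> 1"
      by (auto simp: p_def intro!: prob_space.prob_le_1 prob_space_PiM V.prob_space_axioms)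
  qed measurable
  have qi: "integrable ?Y (\<lambda>c. q (?N c))"
  proof (rule Y.integrable_const_bound[where B=1])
    show "AE c in ?Y. norm (q (?N c)) \<le> 1"
      by (auto simp: q_def intro!: prob_space.prob_le_1 prob_space_PiM K.prob_space_axioms)
  qed measurable
  note N = expected_stop_index[OF D M b]
  have "a * (\<integral>c. p (?N c) \<partial>?Y) = (\<integral>c. a * p (?N c) \<partial>?Y)" by simp
  also have "\<dots> \<le> (\<integral>k. real (?N k) * c + (exp a - 1) * q (?N k) \<partial>?Y)"
  proof (rule integral_mono)
    show "a * p (?N k) \<le> real (?N k) * c + (exp a - 1) * q (?N k)" for k
      unfolding p_def q_def
      using KL_sample_event_bound[OF assms(1,2) _ KL B] s\<nu> s\<kappa> by simp
  qed (use pi qi N(1) in auto)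
  also have "\<dots> = (\<integral>k. real (?N k) \<partial>?Y) * c + (exp a - 1) * (\<integral>k. q (?N k) \<partial>?Y)"
    using qi N(1) by simp
  also have "(\<integral>k. real (?N k) \<partial>?Y) * c \<le> (C \<delta> + M) / (\<integral>x. min x M \<partial>D) * c"
    using KL_bound_nonneg[OF assms(1,2) _ KL] s\<nu> s\<kappa> N(2) by (intro mult_right_mono) auto
  finally show ?thesis
    using reported_event(2)[where f=f and \<delta>=\<delta> and C=C, OF assms(1) s\<nu> D f U]
      reported_event(2)[where f=f and \<delta>=\<delta> and C=C, OF assms(2) s\<kappa> D f U]
    by (simp add: p_def q_def B_def)
qed

lemma truncated_mean_tendsto:
  assumes "cost_distribution D"
  shows "(\<lambda>n. \<integral>x. min x (real n) \<partial>D) \<longlonglongrightarrow> mean D"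
proof -
  have [measurable_cong]: "sets D = sets borel" and pos: "AE c in D. 0 < c" and int: "integrable D (\<lambda>c. c)"
    using assms by (auto simp: cost_distribution_def)
  show ?thesis
  proof (rule integral_dominated_convergence[where w="\<lambda>x. \<bar>x\<bar>"])
    show "integrable D (\<lambda>x. \<bar>x\<bar>)" using int by (rule integrable_abs)
    show "AE x in D. (\<lambda>n. min x (real n)) \<longlonglongrightarrow> x"
    proof (rule AE_I2)
      fix x :: real
      have "eventually (\<lambda>n. x \<le> real n) sequentially"
        using eventually_ge_at_top[of "nat \<lceil>x\<rceil>"] by eventually_elim linarith
      then have "eventually (\<lambda>n. min x (real n) = x) sequentially"
        by eventually_elim auto
      then show "(\<lambda>n. min x (real n)) \<longlonglongrightarrow> x" by (rule tendsto_eventually)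
    qed
    show "AE x in D. norm (min x (real n)) \<le> \<bar>x\<bar>" for n
      using pos by eventually_elim auto
  qed measurable
qed

text \<open>
  An event of probability at most \<open>\<delta>\<close> under \<open>\<kappa>\<close> that becomes certain under \<open>\<nu>\<close> needs about
  \<open>ln (1 / \<delta>) / KL\<close> samples, hence about \<open>mean D * ln (1 / \<delta>) / KL\<close> of budget. The weight
  \<open>a = ln (1 / \<delta>)\<close> is chosen such that \<open>exp a * \<delta> = 1\<close>: the term of the rare event stays bounded and
  vanishes after division by \<open>ln (1 / \<delta>)\<close>.
\<close>

lemma information_budget:
  assumes "prob_space \<nu>" "prob_space \<kappa>" and s\<nu>: "sets \<nu> = sets borel" and s\<kappa>: "sets \<kappa> = sets borel"
    and KL: "KL \<nu> \<kappa> \<le> ereal c" and D: "cost_distribution D"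
    and C: "filterlim C at_top (at_right 0)" and k: "((\<lambda>\<delta>. C \<delta> / ln (1 / \<delta>)) \<longlongrightarrow> k) (at_right 0)"
    and f: "\<And>n \<delta>. \<delta> \<in> {0<..<1} \<Longrightarrow> f n \<delta> \<in> borel_measurable (\<Pi>\<^sub>M i\<in>{..<n}. borel)"
    and U: "U \<in> sets borel"
    and likely: "((\<lambda>\<delta>. measure (joint_law \<nu> D)
        {\<omega> \<in> space (joint_law \<nu> D). reported f C \<delta> \<omega> \<in> U}) \<longlongrightarrow> 1) (at_right 0)"
    and rare: "\<And>\<delta>. \<delta> \<in> {0<..<1} \<Longrightarrow> measure (joint_law \<kappa> D)
        {\<omega> \<in> space (joint_law \<kappa> D). reported f C \<delta> \<omega> \<in> U} \<le> \<delta>"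
  shows "mean D \<le> k * c"
proof -
  let ?P = "\<lambda>\<delta>. measure (joint_law \<nu> D) {\<omega> \<in> space (joint_law \<nu> D). reported f C \<delta> \<omega> \<in> U}"
  have at0: "eventually (\<lambda>\<delta>::real. \<delta> \<in> {0<..<1}) (at_right 0)"
    by (rule eventually_at_right_real) simp
  have ln_top: "filterlim (\<lambda>\<delta>::real. ln (1 / \<delta>)) at_top (at_right 0)"
    using filterlim_compose[OF ln_at_top filterlim_inverse_at_top_right]
    by (simp add: inverse_eq_divide)
  have inv: "((\<lambda>\<delta>::real. 1 / ln (1 / \<delta>)) \<longlongrightarrow> 0) (at_right 0)"
    using tendsto_divide_0[OF tendsto_const filterlim_at_top_imp_at_infinity[OF ln_top]] .
  have bound: "(\<integral>x. min x M \<partial>D) \<le> k * c" if M: "0 < M" for M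
  proof -
    let ?d = "\<integral>x. min x M \<partial>D"
    note d = truncated_cost_mean_pos(1)[OF D M]
    define e where "e = c / ?d"
    have "1 \<le> (k + M * 0) * e + 0"
    proof (rule tendsto_le[OF _ _ likely])
      show "((\<lambda>\<delta>. (C \<delta> / ln (1 / \<delta>) + M * (1 / ln (1 / \<delta>))) * e + 1 / ln (1 / \<delta>))
          \<longlongrightarrow> (k + M * 0) * e + 0) (at_right 0)"
        by (intro tendsto_add[OF tendsto_mult_right[OF tendsto_add[OF k tendsto_mult_left[OF inv]]] inv])
      have "eventually (\<lambda>\<delta>. 0 \<le> C \<delta>) (at_right 0)"
        using C by (auto simp: filterlim_at_top)
      then show "eventually (\<lambda>\<delta>. ?P \<delta> \<le> (C \<delta> / ln (1 / \<delta>) + M * (1 / ln (1 / \<delta>))) * e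
          + 1 / ln (1 / \<delta>)) (at_right 0)"
        using at0
      proof eventually_elim
        case (elim \<delta>)
        then have \<delta>: "0 < \<delta>" "\<delta> < 1" by auto
        define l where "l = ln (1 / \<delta>)"
        have l: "0 < l" using \<delta> by (simp add: l_def)
        have el: "exp l = 1 / \<delta>" using \<delta> by (simp add: l_def)
        let ?q = "measure (joint_law \<kappa> D) {\<omega> \<in> space (joint_law \<kappa> D). reported f C \<delta> \<omega> \<in> U}"
        have "(exp l - 1) * ?q \<le> (exp l - 1) * \<delta>"
          using rare[of \<delta>] \<delta> by (intro mult_left_mono) (auto simp: el)
        also have "\<dots> \<le> 1" using \<delta> by (simp add: el field_simps)
        finally have "l * ?P \<delta> \<le> (C \<delta> + M) * e + 1"
          using change_of_measure_reported[where f=f and \<delta>=\<delta> and C=C and a=l,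
              OF assms(1,2) s\<nu> s\<kappa> KL D f U M] elim
          by (force simp: e_def)
        then have "?P \<delta> \<le> ((C \<delta> + M) * e + 1) / l"
          using l by (simp add: pos_le_divide_eq mult.commute)
        also have "\<dots> = (C \<delta> / l + M * (1 / l)) * e + 1 / l"
          by (simp add: add_divide_distrib distrib_right)
        finally show ?case by (simp add: l_def)
      qed
    qed simp
    then have "1 \<le> k * c / ?d" by (simp add: e_def)
    then show ?thesis using d by (simp add: pos_le_divide_eq)
  qed
  show ?thesis
  proof (rule LIMSEQ_le_const2[OF truncated_mean_tendsto[OF D]])
    show "\<exists>N. \<forall>n\<ge>N. (\<integral>x. min x (real n) \<partial>D) \<le> k * c"
      using bound by (intro exI[of _ 1]) auto
  qed
qed

section \<open>Divergence from mixtures\<close>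

definition mixture :: "real \<Rightarrow> real measure \<Rightarrow> real measure \<Rightarrow> real measure" where
  "mixture t \<kappa> \<eta> = measure_pmf (bernoulli_pmf t) \<bind> (\<lambda>b. if b then \<kappa> else \<eta>)"

context
  fixes t :: real and \<kappa> \<eta> :: "real measure"
  assumes t: "0 < t" "t < 1"
    and K: "prob_space \<kappa>" "sets \<kappa> = sets borel" and E: "prob_space \<eta>" "sets \<eta> = sets borel"
begin

lemma mixture_kernel:
  "(\<lambda>b. if b then \<kappa> else \<eta>) \<in> measurable (measure_pmf (bernoulli_pmf t)) (subprob_algebra borel)"
  using K E by (auto simp: space_subprob_algebra prob_space_imp_subprob_space)

lemma sets_mixture: "sets (mixture t \<kappa> \<eta>) = sets borel"
  unfolding mixture_def using K E by (intro sets_bind) auto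

lemma nn_integral_mixture:
  assumes "f \<in> borel_measurable borel"
  shows "(\<integral>\<^sup>+x. f x \<partial>mixture t \<kappa> \<eta>) = ennreal t * (\<integral>\<^sup>+x. f x \<partial>\<kappa>) + ennreal (1 - t) * (\<integral>\<^sup>+x. f x \<partial>\<eta>)"
  unfolding mixture_def
  using t by (subst nn_integral_bind[OF assms mixture_kernel])
    (simp add: nn_integral_measure_pmf_finite[OF finite] UNIV_bool mult.commute)

lemma emeasure_mixture:
  assumes "A \<in> sets borel"
  shows "emeasure (mixture t \<kappa> \<eta>) A = ennreal t * emeasure \<kappa> A + ennreal (1 - t) * emeasure \<eta> A"
  using nn_integral_mixture[of "indicator A"] assms K E by (simp add: sets_mixture)

lemma prob_space_mixture: "prob_space (mixture t \<kappa> \<eta>)"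
  unfolding mixture_def using K E
  by (intro prob_space.prob_space_bind[OF _ _ mixture_kernel] measure_pmf.prob_space_axioms) auto

lemma integral_mixture:
  fixes f :: "real \<Rightarrow> real"
  assumes f [measurable]: "f \<in> borel_measurable borel" and "integrable \<kappa> f" "integrable \<eta> f"
  shows "integrable (mixture t \<kappa> \<eta>) f"
    and "(\<integral>x. f x \<partial>mixture t \<kappa> \<eta>) = t * (\<integral>x. f x \<partial>\<kappa>) + (1 - t) * (\<integral>x. f x \<partial>\<eta>)"
proof -
  note [measurable_cong] = sets_mixture
  have abs: "(\<integral>\<^sup>+x. ennreal \<bar>f x\<bar> \<partial>\<rho>) < \<infinity>" "(\<integral>\<^sup>+x. ennreal (f x) \<partial>\<rho>) < \<infinity>"
    "(\<integral>\<^sup>+x. ennreal (- f x) \<partial>\<rho>) < \<infinity>" if "integrable \<rho> f" for \<rho>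
    using that that[unfolded real_integrable_def] unfolding integrable_iff_bounded
    by (auto simp: less_top)
  note fin = abs[OF assms(2)] abs[OF assms(3)]
  show int: "integrable (mixture t \<kappa> \<eta>) f"
    using fin
    by (intro integrableI_bounded) (auto simp: nn_integral_mixture ennreal_mult_less_top)
  show "(\<integral>x. f x \<partial>mixture t \<kappa> \<eta>) = t * (\<integral>x. f x \<partial>\<kappa>) + (1 - t) * (\<integral>x. f x \<partial>\<eta>)"
    using fin t
    unfolding real_lebesgue_integral_def[OF int] real_lebesgue_integral_def[OF assms(2)]
      real_lebesgue_integral_def[OF assms(3)]
    by (simp add: nn_integral_mixture enn2real_plus enn2real_mult ennreal_mult_less_top algebra_simps)
qed

text \<open>
  Both components are absolutely continuous with respect to the mixture, and their densities average
  to 1. This reduces inequalities for the divergence from a mixture to pointwise ones.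
\<close>

lemma mixture_component_densities:
  obtains u v :: "real \<Rightarrow> real" where "u \<in> borel_measurable borel" "v \<in> borel_measurable borel"
    "\<And>x. 0 \<le> u x" "\<And>x. 0 \<le> v x"
    "\<kappa> = density (mixture t \<kappa> \<eta>) (\<lambda>x. ennreal (u x))"
    "\<eta> = density (mixture t \<kappa> \<eta>) (\<lambda>x. ennreal (v x))"
    "AE x in mixture t \<kappa> \<eta>. t * u x + (1 - t) * v x = 1"
proof -
  let ?m = "mixture t \<kappa> \<eta>"
  interpret m: prob_space ?m by (rule prob_space_mixture)
  note [measurable_cong] = sets_mixture
  have dens: "\<exists>u::real \<Rightarrow> real. u \<in> borel_measurable borel \<and> (\<forall>x. 0 \<le> u x) \<and> \<rho> = density ?m (\<lambda>x. ennreal (u x))"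
    if R: "prob_space \<rho>" "sets \<rho> = sets borel"
      and null: "\<And>A. A \<in> sets borel \<Longrightarrow> emeasure ?m A = 0 \<Longrightarrow> emeasure \<rho> A = 0" for \<rho>
  proof -
    have ac: "absolutely_continuous ?m \<rho>"
      using null R by (auto simp: absolutely_continuous_def null_sets_def sets_mixture)
    have s: "sets \<rho> = sets ?m" using R sets_mixture by simp
    have "AE x in ?m. RN_deriv ?m \<rho> x \<noteq> \<infinity>"
      using ac s R by (intro m.RN_deriv_finite) (auto intro: prob_space_imp_sigma_finite)
    then have "density ?m (\<lambda>x. ennreal (enn2real (RN_deriv ?m \<rho> x))) = density ?m (RN_deriv ?m \<rho>)"
      by (intro density_cong) (auto elim!: AE_mp simp: less_top)
    then have "\<rho> = density ?m (\<lambda>x. ennreal (enn2real (RN_deriv ?m \<rho> x)))"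
      using m.density_RN_deriv[OF ac s] by simp
    moreover have "(\<lambda>x. enn2real (RN_deriv ?m \<rho> x)) \<in> borel_measurable borel"
    proof -
      have "(\<lambda>x. enn2real (RN_deriv ?m \<rho> x)) \<in> borel_measurable ?m" by measurable
      then show ?thesis by (simp add: measurable_cong_sets[OF sets_mixture refl])
    qed
    ultimately show ?thesis by (intro exI[of _ "\<lambda>x. enn2real (RN_deriv ?m \<rho> x)"]) auto
  qed
  obtain u :: "real \<Rightarrow> real" where u: "u \<in> borel_measurable borel" "\<And>x. 0 \<le> u x" "\<kappa> = density ?m (\<lambda>x. ennreal (u x))"
    using dens[OF K] t by (auto simp: emeasure_mixture ennreal_eq_0_iff)
  obtain v :: "real \<Rightarrow> real" where v: "v \<in> borel_measurable borel" "\<And>x. 0 \<le> v x" "\<eta> = density ?m (\<lambda>x. ennreal (v x))"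
    using dens[OF E] t by (auto simp: emeasure_mixture ennreal_eq_0_iff)
  note [measurable] = u(1) v(1)
  have "density ?m (\<lambda>x. ennreal (t * u x + (1 - t) * v x)) = density ?m (\<lambda>_. 1)"
  proof (rule measure_eqI)
    fix A assume "A \<in> sets (density ?m (\<lambda>x. ennreal (t * u x + (1 - t) * v x)))"
    then have A [measurable]: "A \<in> sets borel" by (simp add: sets_mixture)
    have "emeasure (density ?m (\<lambda>x. ennreal (t * u x + (1 - t) * v x))) A
        = (\<integral>\<^sup>+x. ennreal t * (ennreal (u x) * indicator A x)
            + ennreal (1 - t) * (ennreal (v x) * indicator A x) \<partial>?m)"
      using t u(2) v(2)
      by (subst emeasure_density) (auto intro!: nn_integral_cong simp: ennreal_mult' distrib_right mult.assoc split: split_indicator)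
    also have "\<dots> = ennreal t * emeasure (density ?m (\<lambda>x. ennreal (u x))) A
        + ennreal (1 - t) * emeasure (density ?m (\<lambda>x. ennreal (v x))) A"
      by (simp add: nn_integral_add nn_integral_cmult emeasure_density sets_mixture)
    also have "\<dots> = emeasure ?m A"
      by (simp add: emeasure_mixture flip: u(3) v(3))
    also have "\<dots> = emeasure (density ?m (\<lambda>_. 1)) A"
      by (simp add: emeasure_density sets_mixture)
    finally show "emeasure (density ?m (\<lambda>x. ennreal (t * u x + (1 - t) * v x))) A
      = emeasure (density ?m (\<lambda>_. 1)) A" .
  qed simp
  then have "AE x in ?m. ennreal (t * u x + (1 - t) * v x) = 1"
    by (intro m.density_unique) auto
  then have "AE x in ?m. t * u x + (1 - t) * v x = 1"
    by eventually_elim (simp add: ennreal_eq_1)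
  then show thesis using u v by (intro that)
qed

end

lemma density_wrt_mixture:
  assumes t: "0 < t" "t < 1" and V: "prob_space \<nu>" "sets \<nu> = sets borel"
    and K: "prob_space \<kappa>" "sets \<kappa> = sets borel" and E: "prob_space \<eta>" "sets \<eta> = sets borel"
    and KL: "KL \<nu> \<kappa> \<le> ereal c"
  obtains g u v :: "real \<Rightarrow> real" where
    "g \<in> borel_measurable borel" "u \<in> borel_measurable borel" "v \<in> borel_measurable borel"
    "\<And>x. 0 \<le> g x" "\<And>x. 0 \<le> u x" "\<And>x. 0 \<le> v x"
    "integrable \<nu> (\<lambda>x. ln (g x))" "(\<integral>x. ln (g x) \<partial>\<nu>) \<le> c"
    "\<nu> = density (mixture t \<kappa> \<eta>) (\<lambda>x. ennreal (u x * g x))"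
    "\<eta> = density (mixture t \<kappa> \<eta>) (\<lambda>x. ennreal (v x))"
    "AE x in \<nu>. 0 < u x * g x" "AE x in \<nu>. t * u x + (1 - t) * v x = 1"
proof -
  let ?m = "mixture t \<kappa> \<eta>"
  note [measurable_cong] = sets_mixture[OF t K E]
  obtain g where g: "g \<in> borel_measurable \<kappa>" "\<And>x. 0 \<le> g x" "\<nu> = density \<kappa> (\<lambda>x. ennreal (g x))"
    "integrable \<nu> (\<lambda>x. ln (g x))" "(\<integral>x. ln (g x) \<partial>\<nu>) \<le> c"
    using KL_finite_obtains_density[OF V(1) K(1) _ KL] V K by auto
  obtain u v :: "real \<Rightarrow> real" where uv: "u \<in> borel_measurable borel" "v \<in> borel_measurable borel"
    "\<And>x. 0 \<le> u x" "\<And>x. 0 \<le> v x" "\<kappa> = density ?m (\<lambda>x. ennreal (u x))"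
    "\<eta> = density ?m (\<lambda>x. ennreal (v x))" "AE x in ?m. t * u x + (1 - t) * v x = 1"
    using mixture_component_densities[OF t K E] by blast
  have gb: "g \<in> borel_measurable borel" using g(1) K(2) by (simp cong: measurable_cong_sets)
  note [measurable] = uv(1,2) gb
  have dens: "\<nu> = density ?m (\<lambda>x. ennreal (u x * g x))"
  proof -
    have "\<nu> = density (density ?m (\<lambda>x. ennreal (u x))) (\<lambda>x. ennreal (g x))"
      using g(3) uv(5) by simp
    also have "\<dots> = density ?m (\<lambda>x. ennreal (u x * g x))"
      using uv(3) by (subst density_density_eq) (auto simp: ennreal_mult')
    finally show ?thesis .
  qed
  have pos: "AE x in \<nu>. 0 < u x * g x"
    using uv(3) g(2) by (subst dens, subst AE_density) (auto simp: ennreal_eq_0_iff)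
  have one: "AE x in \<nu>. t * u x + (1 - t) * v x = 1"
    using uv(7) by (subst dens, subst AE_density) (auto elim!: AE_mp)
  show thesis
    by (rule that[OF gb uv(1,2) g(2) uv(3,4) g(4,5) dens uv(6) pos one])
qed

text \<open>
  Mixing another measure into the reference costs at most \<open>- ln t\<close>, since \<open>\<kappa>\<close> has a density of at
  most \<open>1 / t\<close> with respect to the mixture.
\<close>

lemma KL_mixture_le_log:
  assumes t: "0 < t" "t < 1" and V: "prob_space \<nu>" "sets \<nu> = sets borel"
    and K: "prob_space \<kappa>" "sets \<kappa> = sets borel" and E: "prob_space \<eta>" "sets \<eta> = sets borel"
    and KL: "KL \<nu> \<kappa> \<le> ereal c"
  shows "KL \<nu> (mixture t \<kappa> \<eta>) \<le> ereal (c - ln t)"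
proof -
  let ?m = "mixture t \<kappa> \<eta>"
  interpret V: prob_space \<nu> by fact
  note [measurable_cong] = sets_mixture[OF t K E]
  obtain g u v :: "real \<Rightarrow> real" where meas [measurable]: "g \<in> borel_measurable borel"
      "u \<in> borel_measurable borel"
    and nn: "\<And>x. 0 \<le> g x" "\<And>x. 0 \<le> u x" "\<And>x. 0 \<le> v x"
    and g: "integrable \<nu> (\<lambda>x. ln (g x))" "(\<integral>x. ln (g x) \<partial>\<nu>) \<le> c"
    and dens: "\<nu> = density ?m (\<lambda>x. ennreal (u x * g x))"
    and pos: "AE x in \<nu>. 0 < u x * g x" and one: "AE x in \<nu>. t * u x + (1 - t) * v x = 1"
    by (rule density_wrt_mixture[OF t V K E KL], rule that)
  show ?thesis
  proof (rule KL_le_of_log_density_le[OF V(1) prob_space_mixture[OF t K E] _ _ dens])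
    show "AE x in \<nu>. ln (u x * g x) \<le> ln (g x) - ln t"
      using pos one
    proof eventually_elim
      case (elim x)
      then have p: "0 < u x" "0 < g x" using nn(1,2)[of x] by (auto simp: zero_less_mult_iff)
      have "t * u x \<le> 1" using elim(2) nn(3)[of x] t by (smt (verit) mult_nonneg_nonneg)
      then have "ln (t * u x) \<le> 0" using p t by simp
      then show ?case using p t by (simp add: ln_mult)
    qed
    show "integrable \<nu> (\<lambda>x. ln (g x) - ln t)" using g(1) by simp
    show "(\<integral>x. ln (g x) - ln t \<partial>\<nu>) \<le> c - ln t" using g V.prob_space by simp
  qed (use nn in auto)
qed

text \<open>
  Convexity of the divergence on the segment from \<open>\<kappa>\<close> to \<open>\<nu>\<close>, where it vanishes at \<open>\<nu>\<close>. Pointwise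
  it is the concavity of the logarithm.
\<close>

lemma KL_mixture_with_first_argument:
  assumes t: "0 < t" "t < 1" and V: "prob_space \<nu>" "sets \<nu> = sets borel"
    and K: "prob_space \<kappa>" "sets \<kappa> = sets borel"
    and KL: "KL \<nu> \<kappa> \<le> ereal c"
  shows "KL \<nu> (mixture t \<kappa> \<nu>) \<le> ereal (t * c)"
proof -
  let ?m = "mixture t \<kappa> \<nu>"
  interpret m: prob_space ?m by (rule prob_space_mixture[OF t K V])
  note [measurable_cong] = sets_mixture[OF t K V]
  obtain g u v :: "real \<Rightarrow> real" where meas [measurable]: "g \<in> borel_measurable borel"
      "u \<in> borel_measurable borel" "v \<in> borel_measurable borel"
    and nn: "\<And>x. 0 \<le> g x" "\<And>x. 0 \<le> u x" "\<And>x. 0 \<le> v x"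
    and g: "integrable \<nu> (\<lambda>x. ln (g x))" "(\<integral>x. ln (g x) \<partial>\<nu>) \<le> c"
    and dens: "\<nu> = density ?m (\<lambda>x. ennreal (u x * g x))" "\<nu> = density ?m (\<lambda>x. ennreal (v x))"
    and pos: "AE x in \<nu>. 0 < u x * g x" and one: "AE x in \<nu>. t * u x + (1 - t) * v x = 1"
    by (rule density_wrt_mixture[OF t V K V KL], rule that)
  \<comment> \<open>Both \<open>v\<close> and \<open>u * g\<close> are densities of \<open>\<nu>\<close>; hence \<open>u = 1 / (t + (1 - t) * g)\<close>.\<close>
  have "AE x in ?m. ennreal (v x) = ennreal (u x * g x)"
    using dens by (intro m.density_unique) auto
  then have "AE x in ?m. v x = u x * g x"
    using nn by (auto elim!: AE_mp)
  then have veq: "AE x in \<nu>. v x = u x * g x"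
    by (subst dens(1), subst AE_density) (auto elim!: AE_mp)
  show ?thesis
  proof (rule KL_le_of_log_density_le[OF V(1) m.prob_space_axioms _ _ dens(1)])
    show "AE x in \<nu>. ln (u x * g x) \<le> t * ln (g x)"
      using pos one veq
    proof eventually_elim
      case (elim x)
      then have p: "0 < u x" "0 < g x" using nn(1,2)[of x] by (auto simp: zero_less_mult_iff)
      have "u x * (t + (1 - t) * g x) = 1" using elim(2,3) by (simp add: algebra_simps)
      moreover have q: "0 < t + (1 - t) * g x" using p t by (simp add: add_pos_pos)
      ultimately have "ln (u x) = - ln (t + (1 - t) * g x)"
        using p by (metis add.right_neutral add_eq_0_iff2 ln_mult ln_one less_numeral_extra(3))
      moreover have "(1 - t) * ln (g x) \<le> ln (t + (1 - t) * g x)"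
        using ln_concave p t concave_onD[OF ln_concave, of "1 - t" 1 "g x"] by simp
      ultimately show ?case using p by (simp add: ln_mult algebra_simps)
    qed
    show "integrable \<nu> (\<lambda>x. t * ln (g x))" using g(1) by simp
    show "(\<integral>x. t * ln (g x) \<partial>\<nu>) \<le> t * c" using g t by simp
  qed (use nn in auto)
qed

lemma KL_self:
  assumes "prob_space \<nu>" "sets \<nu> = sets borel"
  shows "KL \<nu> \<nu> \<le> 0"
  using KL_le_of_log_density_le[of \<nu> \<nu> "\<lambda>_. 1" "\<lambda>_. 0" 0] assms
  by (auto simp: density_1 zero_ereal_def)

section \<open>Divergence from the alternatives with a more extreme mean\<close>

text \<open>
  One end of the range of means of a family: the upper end for \<open>s = 1\<close> and the lower end for \<open>s = -1\<close>,
  so that \<open>s * mean\<close> grows towards the end \<open>s * e\<close> in both cases. The last assumption says that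
  measures whose mean is close to the end concentrate there: a function that vanishes at most at \<open>e\<close>
  has an integral which is controlled by the distance of the mean from the end.
\<close>

locale extreme_mean =
  fixes P :: "real measure set" and s e :: real
  assumes prob: "\<And>\<kappa>. \<kappa> \<in> P \<Longrightarrow> prob_space \<kappa>"
    and sets: "\<And>\<kappa>. \<kappa> \<in> P \<Longrightarrow> sets \<kappa> = sets borel"
    and integrable: "\<And>\<kappa>. \<kappa> \<in> P \<Longrightarrow> integrable \<kappa> (\<lambda>x. x)"
    and mixture: "\<And>t \<kappa> \<eta>. 0 < t \<Longrightarrow> t < 1 \<Longrightarrow> \<kappa> \<in> P \<Longrightarrow> \<eta> \<in> P \<Longrightarrow> mixture t \<kappa> \<eta> \<in> P"
    and dirac: "return borel e \<in> P"
    and excess: "\<exists>\<phi> K. \<phi> \<in> borel_measurable borel \<and> (\<forall>x. 0 \<le> \<phi> x) \<and> (\<forall>x. \<phi> x = 0 \<longrightarrow> x = e) \<and> 0 < K \<and>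
        (\<forall>\<kappa>\<in>P. (\<integral>\<^sup>+x. ennreal (\<phi> x) \<partial>\<kappa>) \<le> ennreal (K * (s * e - s * mean \<kappa>)))"
begin

text \<open>
  \<^const>\<open>KL_inf\<close> seen from one side: the cost of reaching a mean at least as extreme as \<open>y\<close>.
\<close>

definition divergence_beyond :: "real measure \<Rightarrow> real \<Rightarrow> ereal" where
  "divergence_beyond \<nu> y = (INF \<kappa>\<in>{\<kappa> \<in> P. y \<le> s * mean \<kappa>}. KL \<nu> \<kappa>)"

lemma divergence_beyond_mono: "y \<le> y' \<Longrightarrow> divergence_beyond \<nu> y \<le> divergence_beyond \<nu> y'"
  unfolding divergence_beyond_def by (rule INF_superset_mono) auto

lemma divergence_beyond_le:
  "\<kappa> \<in> P \<Longrightarrow> y \<le> s * mean \<kappa> \<Longrightarrow> KL \<nu> \<kappa> \<le> a \<Longrightarrow> divergence_beyond \<nu> y \<le> a"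
  unfolding divergence_beyond_def by (rule INF_lower2) auto

lemma divergence_beyond_witness:
  assumes "divergence_beyond \<nu> y < a"
  obtains \<kappa> where "\<kappa> \<in> P" "y \<le> s * mean \<kappa>" "KL \<nu> \<kappa> \<le> a"
  using assms unfolding divergence_beyond_def INF_less_iff by (auto intro: less_imp_le)

lemma mean_mixture:
  assumes "0 < t" "t < 1" "\<kappa> \<in> P" "\<eta> \<in> P"
  shows "mean (mixture t \<kappa> \<eta>) = t * mean \<kappa> + (1 - t) * mean \<eta>"
  using assms by (intro integral_mixture) (simp_all add: prob sets integrable)

lemma mean_dirac: "mean (return borel e) = e"
  by (simp add: integral_return)

lemma mixture_with_first_argument:
  assumes t: "0 < t" "t < 1" and P: "\<nu> \<in> P" "\<kappa> \<in> P" and KL: "KL \<nu> \<kappa> \<le> ereal a" and y: "y \<le> s * mean \<kappa>"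
  shows "\<exists>\<kappa>'\<in>P. t * y + (1 - t) * (s * mean \<nu>) \<le> s * mean \<kappa>' \<and> KL \<nu> \<kappa>' \<le> ereal (t * a)"
proof (intro bexI[OF _ mixture[OF t P(2,1)]] conjI)
  have "t * y \<le> t * (s * mean \<kappa>)" using t y by (intro mult_left_mono) auto
  then show "t * y + (1 - t) * (s * mean \<nu>) \<le> s * mean (mixture t \<kappa> \<nu>)"
    using t P by (simp add: mean_mixture algebra_simps)
  show "KL \<nu> (mixture t \<kappa> \<nu>) \<le> ereal (t * a)"
    using t P KL by (intro KL_mixture_with_first_argument) (simp_all add: prob sets)
qed

lemma mixture_with_dirac:
  assumes t: "0 < t" "t < 1" and P: "\<nu> \<in> P" "\<kappa> \<in> P" and KL: "KL \<nu> \<kappa> \<le> ereal a" and y: "y \<le> s * mean \<kappa>"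
  shows "\<exists>\<kappa>'\<in>P. t * y + (1 - t) * (s * e) \<le> s * mean \<kappa>' \<and> KL \<nu> \<kappa>' \<le> ereal (a - ln t)"
proof (intro bexI[OF _ mixture[OF t P(2) dirac]] conjI)
  have "t * y \<le> t * (s * mean \<kappa>)" using t y by (intro mult_left_mono) auto
  then show "t * y + (1 - t) * (s * e) \<le> s * mean (mixture t \<kappa> (return borel e))"
    using t P dirac by (simp add: mean_mixture mean_dirac algebra_simps)
  show "KL \<nu> (mixture t \<kappa> (return borel e)) \<le> ereal (a - ln t)"
    using t P KL dirac by (intro KL_mixture_le_log) (simp_all add: prob sets prob_space_return)
qed

text \<open>
  If the mean of \<open>\<nu>\<close> is not extreme, then \<open>\<nu>\<close> gives positive probability \<open>p\<close> to some event
  \<open>\<phi> \<ge> c\<close> away from the extreme point. By Markov's inequality this event has arbitrarily small probability under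
  every member of the family whose mean is close enough to the end, so the divergence is large.
\<close>

lemma divergence_beyond_blowup:
  assumes \<nu>: "\<nu> \<in> P" and not_extreme: "s * mean \<nu> < s * e"
  obtains y0 where "y0 < s * e" "\<And>y. y0 \<le> y \<Longrightarrow> ereal v < divergence_beyond \<nu> y"
proof -
  interpret V: prob_space \<nu> using \<nu> by (rule prob)
  obtain \<phi> K where \<phi>: "\<phi> \<in> borel_measurable borel" "\<And>x. 0 \<le> \<phi> x" "\<And>x. \<phi> x = 0 \<Longrightarrow> x = e" "0 < K"
    and le: "\<And>\<kappa>. \<kappa> \<in> P \<Longrightarrow> (\<integral>\<^sup>+x. ennreal (\<phi> x) \<partial>\<kappa>) \<le> ennreal (K * (s * e - s * mean \<kappa>))"
    using excess by blast
  note [measurable] = \<phi>(1)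
  have meas [measurable]: "{x. c \<le> \<phi> x} \<in> sets borel" for c by measurable
  have "\<exists>c>0. 0 < measure \<nu> {x. c \<le> \<phi> x}"
  proof (rule ccontr)
    assume "\<not> ?thesis"
    then have z: "measure \<nu> {x. c \<le> \<phi> x} = 0" if "0 < c" for c
      using that by (meson measure_nonneg not_le_imp_less order_antisym)
    have "AE x in \<nu>. \<phi> x < 1 / real (Suc n)" for n
      using z[of "1 / real (Suc n)"]
      by (intro AE_I[of _ _ "{x. 1 / real (Suc n) \<le> \<phi> x}"])
        (auto simp: V.emeasure_eq_measure sets[OF \<nu>] not_less)
    then have "AE x in \<nu>. \<forall>n. \<phi> x < 1 / real (Suc n)" by (simp add: AE_all_countable)
    then have "AE x in \<nu>. x = e"
    proof eventually_elim
      case (elim x)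
      then have "\<not> 0 < \<phi> x"
        by (metis inverse_eq_divide not_less_iff_gr_or_eq reals_Archimedean)
      then show ?case using \<phi>(2,3)[of x] by (auto simp: not_less)
    qed
    then have "mean \<nu> = (\<integral>x. e \<partial>\<nu>)"
      by (intro integral_cong_AE[OF borel_measurable_integrable[OF integrable[OF \<nu>]]]) simp_all
    then show False using not_extreme V.prob_space by simp
  qed
  then obtain c where c: "0 < c" "0 < measure \<nu> {x. c \<le> \<phi> x}" by blast
  define A where "A = {x. c \<le> \<phi> x}"
  define p where "p = measure \<nu> A"
  have p: "0 < p" using c(2) by (simp add: p_def A_def)
  \<comment> \<open>With weight \<open>a\<close> the event contributes \<open>v + 2\<close> under \<open>\<nu>\<close> and, beyond \<open>y0\<close>, less than 1 under \<open>\<kappa>\<close>;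
      the difference is a lower bound of the divergence.\<close>
  define a where "a = (v + 2) / p"
  define y0 where "y0 = s * e - c * exp (- a) / K"
  have far: "ereal (v + 1) \<le> KL \<nu> \<kappa>" if \<kappa>: "\<kappa> \<in> P" and y: "y0 \<le> s * mean \<kappa>" for \<kappa>
  proof (rule ccontr)
    assume "\<not> ?thesis"
    then have KL: "KL \<nu> \<kappa> \<le> ereal (v + 1)" by simp
    interpret Q: prob_space \<kappa> using \<kappa> by (rule prob)
    have spK: "space \<kappa> = UNIV" using sets_eq_imp_space_eq[OF sets[OF \<kappa>]] by simp
    note [measurable_cong] = sets[OF \<kappa>]
    have "emeasure \<kappa> A = emeasure \<kappa> {x \<in> space \<kappa>. 1 \<le> ennreal (1 / c) * ennreal (\<phi> x)}"
      using c \<phi>(2) by (intro arg_cong[where f="emeasure \<kappa>"])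
        (auto simp: A_def spK pos_le_divide_eq simp flip: ennreal_mult')
    also have "\<dots> \<le> ennreal (1 / c) * (\<integral>\<^sup>+x. ennreal (\<phi> x) * indicator (space \<kappa>) x \<partial>\<kappa>)"
      by (rule nn_integral_Markov_inequality) auto
    also have "(\<integral>\<^sup>+x. ennreal (\<phi> x) * indicator (space \<kappa>) x \<partial>\<kappa>) = (\<integral>\<^sup>+x. ennreal (\<phi> x) \<partial>\<kappa>)"
      by (simp add: spK)
    also have "ennreal (1 / c) * (\<integral>\<^sup>+x. ennreal (\<phi> x) \<partial>\<kappa>) \<le> ennreal (1 / c) * ennreal (c * exp (- a))"
    proof (rule mult_left_mono)
      have "s * e - s * mean \<kappa> \<le> c * exp (- a) / K" using y by (simp add: y0_def)
      then have "K * (s * e - s * mean \<kappa>) \<le> c * exp (- a)"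
        using \<phi>(4) by (simp add: pos_le_divide_eq mult.commute)
      then show "(\<integral>\<^sup>+x. ennreal (\<phi> x) \<partial>\<kappa>) \<le> ennreal (c * exp (- a))"
        using le[OF \<kappa>] by (meson ennreal_leI order_trans)
    qed simp
    also have "\<dots> = ennreal (exp (- a))"
      using c by (simp flip: ennreal_mult')
    finally have q: "measure \<kappa> A \<le> exp (- a)"
      by (simp add: Q.emeasure_eq_measure)
    have "v + 2 = a * measure \<nu> A" using p by (simp add: a_def p_def)
    also have "\<dots> \<le> v + 1 + (exp a - 1) * measure \<kappa> A"
      using \<nu> \<kappa> KL by (intro KL_set_bound) (auto intro: prob simp: sets A_def)
    also have "(exp a - 1) * measure \<kappa> A < 1"
    proof (cases "0 \<le> exp a - 1")
      case True
      then have "(exp a - 1) * measure \<kappa> A \<le> (exp a - 1) * exp (- a)"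
        using q by (intro mult_left_mono)
      also have "\<dots> = 1 - exp (- a)" by (simp add: left_diff_distrib flip: exp_add)
      also have "\<dots> < 1" by simp
      finally show ?thesis .
    next
      case False
      then have "(exp a - 1) * measure \<kappa> A \<le> 0"
        by (intro mult_nonpos_nonneg) auto
      then show ?thesis by simp
    qed
    finally show False by simp
  qed
  show thesis
  proof (rule that)
    show "y0 < s * e" using c \<phi>(4) by (simp add: y0_def)
    fix y assume "y0 \<le> y"
    then have "ereal (v + 1) \<le> divergence_beyond \<nu> y"
      unfolding divergence_beyond_def using far by (intro INF_greatest) auto
    moreover have "ereal v < ereal (v + 1)" by simp
    ultimately show "ereal v < divergence_beyond \<nu> y" by (rule less_le_trans[rotated])
  qed
qed

text \<open>
  Any mean strictly before \<open>r\<close> is reached at strictly smaller cost, by moving from a nearly optimal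
  alternative for \<open>r\<close> back towards \<open>\<nu>\<close>. This gives uniqueness of the level \<open>r\<close> and, in the main
  argument, an alternative that the policy cannot afford to exclude.
\<close>

lemma cheaper_before:
  assumes \<nu>: "\<nu> \<in> P" and v: "0 < v" and r: "divergence_beyond \<nu> r = ereal v"
    and y: "s * mean \<nu> < y" "y < r"
  obtains \<kappa> c where "\<kappa> \<in> P" "y \<le> s * mean \<kappa>" "KL \<nu> \<kappa> \<le> ereal c" "c < v"
proof -
  let ?m = "s * mean \<nu>"
  define t where "t = (y - ?m) / (r - ?m)"
  have t: "0 < t" "t < 1" using y by (auto simp: t_def)
  have "t * (r - ?m) = y - ?m" using y by (simp add: t_def)
  then have yt: "t * r + (1 - t) * ?m = y" by (simp add: algebra_simps)
  \<comment> \<open>The midpoint of \<open>v\<close> and \<open>v / t\<close>: above \<open>v\<close>, but \<open>t * a < v\<close>.\<close>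
  define a where "a = v * (1 + 1 / t) / 2"
  have ta: "t * a = v * (1 + t) / 2" using t by (simp add: a_def field_simps)
  have "v * t < v * 1" using t v by (intro mult_strict_left_mono)
  then have "t * v < t * a" unfolding ta by (simp add: algebra_simps)
  then have a: "v < a" using t by (simp only: mult_less_cancel_left_pos)
  have "v * (1 + t) < v * 2" using t v by (intro mult_strict_left_mono) auto
  then have c: "t * a < v" by (simp add: ta)
  have "divergence_beyond \<nu> r < ereal a" using a r by simp
  then obtain \<kappa> where \<kappa>: "\<kappa> \<in> P" "r \<le> s * mean \<kappa>" "KL \<nu> \<kappa> \<le> ereal a"
    by (rule divergence_beyond_witness)
  show thesis
    using mixture_with_first_argument[OF t \<nu> \<kappa>(1,3,2)] yt c that by auto
qed

text \<open>
  Mixtures of \<open>\<nu>\<close> with the extreme point mass reach every mean short of the end; their divergence is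
  finite because \<open>\<nu>\<close> itself is a component.
\<close>

lemma finite_divergence_beyond:
  assumes \<nu>: "\<nu> \<in> P" and m: "s * mean \<nu> < s * e" and x: "x < s * e"
  obtains \<kappa> c where "\<kappa> \<in> P" "x < s * mean \<kappa>" "KL \<nu> \<kappa> \<le> ereal c"
proof -
  let ?m = "s * mean \<nu>" and ?E = "s * e"
  define d where "d = ?E - ?m"
  have d: "0 < d" using m by (simp add: d_def)
  \<comment> \<open>The weight of \<open>\<nu>\<close>, small enough for the mean of the mixture to lie beyond \<open>x\<close>.\<close>
  define t where "t = min (1 / 2) ((?E - x) / (2 * d))"
  have t: "0 < t" "t < 1" using d x by (auto simp: t_def)
  have "t * d \<le> (?E - x) / (2 * d) * d"
    using d by (intro mult_right_mono) (auto simp: t_def)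
  also have "\<dots> = (?E - x) / 2" using d by simp
  finally have "t * d < ?E - x" using x by simp
  then have "x < t * ?m + (1 - t) * ?E" by (simp add: d_def algebra_simps)
  then show thesis
    using mixture_with_dirac[OF t \<nu> \<nu> _ order_refl, of 0] KL_self[of \<nu>] \<nu> prob sets that
    by (force simp: zero_ereal_def)
qed

text \<open>
  The divergence is nondecreasing in the level, starts at 0, and exceeds \<open>v\<close> near the end. Mixing in
  the extreme point mass moves the level from \<open>y\<close> to \<open>t * y + (1 - t) * (s * e)\<close> at a cost of
  \<open>- ln t\<close>; this excludes jumps. So the supremum \<open>r\<close> of the levels with divergence at most \<open>v\<close> has
  divergence exactly \<open>v\<close>.
\<close>

lemma ex1_divergence_beyond_eq:
  assumes \<nu>: "\<nu> \<in> P" and m: "s * mean \<nu> < s * e" and v: "0 < v"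
  shows "\<exists>!r. s * mean \<nu> < r \<and> divergence_beyond \<nu> r = ereal v"
proof -
  let ?G = "divergence_beyond \<nu>" and ?m = "s * mean \<nu>" and ?E = "s * e"
  have towards: "?G (t * y + (1 - t) * ?E) \<le> ereal (a - ln t)"
    if t: "0 < t" "t < 1" and y: "?G y < ereal a" for t y a
  proof -
    obtain \<kappa> where "\<kappa> \<in> P" "y \<le> s * mean \<kappa>" "KL \<nu> \<kappa> \<le> ereal a"
      using y by (rule divergence_beyond_witness)
    then obtain \<kappa>' where "\<kappa>' \<in> P" "t * y + (1 - t) * ?E \<le> s * mean \<kappa>'" "KL \<nu> \<kappa>' \<le> ereal (a - ln t)"
      using mixture_with_dirac[OF t \<nu>] by blast
    then show ?thesis by (rule divergence_beyond_le)
  qed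
  obtain y0 where y0: "y0 < ?E" "\<And>y. y0 \<le> y \<Longrightarrow> ereal v < ?G y"
    using divergence_beyond_blowup[OF \<nu> m] by blast
  define A where "A = {y. ?m \<le> y \<and> ?G y \<le> ereal v}"
  have Gm: "?G ?m \<le> 0"
    using \<nu> KL_self[of \<nu>] by (intro divergence_beyond_le[of \<nu>]) (simp_all add: prob sets)
  have mA: "?m \<in> A" using Gm v by (auto simp: A_def intro: order_trans)
  have ub: "y \<le> y0" if "y \<in> A" for y
    using that y0(2)[of y] by (force simp: A_def)
  have bdd: "bdd_above A" using ub by (rule bdd_aboveI)
  define r where "r = Sup A"
  have rm: "?m \<le> r" unfolding r_def using mA bdd by (rule cSup_upper)
  have rE: "r < ?E" using cSup_least[of A y0] mA ub y0(1) by (force simp: r_def)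
  have "ereal v \<le> ?G r"
  proof (rule ccontr)
    assume "\<not> ?thesis"
    then have "?G r < ereal v" by simp
    then obtain a where a: "?G r < ereal a" "a < v" by (metis ereal_dense2 ereal_less(2) less_ereal.simps(1))
    \<comment> \<open>The slack between \<open>a\<close> and \<open>v\<close> pays for a move beyond the supremum.\<close>
    define t where "t = exp (a - v)"
    have t: "0 < t" "t < 1" using a by (auto simp: t_def)
    have "?G (t * r + (1 - t) * ?E) \<le> ereal v"
      using towards[OF t a(1)] by (simp add: t_def)
    moreover have gt: "r < t * r + (1 - t) * ?E"
      using mult_strict_left_mono[of r ?E "1 - t"] t rE by (simp add: algebra_simps)
    ultimately have "t * r + (1 - t) * ?E \<in> A" using rm by (simp add: A_def)
    then show False using cSup_upper[OF _ bdd] gt by (force simp: r_def)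
  qed
  moreover have "?G r \<le> ereal v"
  proof (rule ccontr)
    assume "\<not> ?thesis"
    then have "ereal v < ?G r" by simp
    then obtain a where a: "ereal a < ?G r" "v < a" by (metis ereal_dense2 ereal_less(2) less_ereal.simps(1))
    define b where "b = (v + a) / 2"
    define t where "t = exp (b - a)"
    have t: "0 < t" "t < 1" and b: "v < b" using a by (auto simp: t_def b_def)
    have gt: "r < t * r + (1 - t) * ?E"
      using mult_strict_left_mono[of r ?E "1 - t"] t rE by (simp add: algebra_simps)
    \<comment> \<open>From every level above \<open>y1\<close> the move with weight \<open>t\<close> arrives beyond \<open>r\<close>.\<close>
    define y1 where "y1 = (r - (1 - t) * ?E) / t"
    have "y1 < r" using gt t by (simp add: y1_def pos_divide_less_eq algebra_simps)
    then obtain y where y: "y \<in> A" "y1 < y"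
      using less_cSup_iff[of A y1] mA bdd by (auto simp: r_def)
    have "r < t * y + (1 - t) * ?E" using y(2) t by (simp add: y1_def pos_divide_less_eq algebra_simps)
    then have "?G r \<le> ?G (t * y + (1 - t) * ?E)" by (intro divergence_beyond_mono) simp
    also have "\<dots> \<le> ereal (b - ln t)"
      using y(1) b by (intro towards t) (auto simp: A_def intro: le_less_trans)
    also have "\<dots> = ereal a" by (simp add: t_def)
    finally show False using a by simp
  qed
  ultimately have Gr: "?G r = ereal v" by (rule order_antisym[rotated])
  have "?m \<noteq> r" using Gm Gr v by auto
  then have "?m < r" using rm by simp
  moreover have False
    if "?m < y" "y < y'" "?G y = ereal v" "?G y' = ereal v" for y y'
    using cheaper_before[OF \<nu> v that(4,1,2)] divergence_beyond_le that(3)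
    by (metis ereal_less_eq(3) leD)
  ultimately show ?thesis using Gr by (intro ex1I[of _ r]) (metis not_less_iff_gr_or_eq)+
qed

end

section \<open>The two families\<close>

text \<open>
  On the unit interval the distance from an endpoint has a constant sign, so its integral equals the
  distance of the mean from that endpoint.
\<close>

lemma extreme_mean_bounded_family:
  assumes "s = 1 \<and> e = 1 \<or> s = -1 \<and> e = 0"
  shows "extreme_mean bounded_family s e"
proof (rule extreme_mean.intro)
  fix \<kappa> assume k: "\<kappa> \<in> bounded_family"
  then show "prob_space \<kappa>" and sets: "sets \<kappa> = sets borel"
    by (auto simp: bounded_family_def)
  then interpret prob_space \<kappa> by simp
  note [measurable_cong] = sets
  show "integrable \<kappa> (\<lambda>x. x)"
    using k by (intro integrable_const_bound[where B=1]) (auto simp: bounded_family_def elim!: AE_mp)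
next
  fix t :: real and \<kappa> \<eta> assume t: "0 < t" "t < 1" and k: "\<kappa> \<in> bounded_family" "\<eta> \<in> bounded_family"
  then have K: "prob_space \<kappa>" "sets \<kappa> = sets borel" and E: "prob_space \<eta>" "sets \<eta> = sets borel"
    by (auto simp: bounded_family_def)
  have null: "emeasure \<rho> (- {0..1}) = 0" if "\<rho> \<in> bounded_family" for \<rho>
  proof -
    have "sets \<rho> = sets borel" "AE x in \<rho>. x \<in> {0..1}"
      using that by (simp_all add: bounded_family_def)
    moreover from this have "{x \<in> space \<rho>. \<not> x \<in> {0..1}} = - {0..1}"
      using sets_eq_imp_space_eq[of \<rho> borel] by auto
    ultimately show ?thesis
      using AE_iff_measurable[of "- {0..1}" \<rho> "\<lambda>x. x \<in> {0..1}"] by simp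
  qed
  have "emeasure (mixture t \<kappa> \<eta>) (- {0..1}) = 0"
    using k by (subst emeasure_mixture[OF t K E]) (auto simp: null)
  then have "AE x in mixture t \<kappa> \<eta>. x \<in> {0..1}"
    by (intro AE_I[where N="- {0..1}"]) (auto simp: sets_mixture[OF t K E])
  then show "mixture t \<kappa> \<eta> \<in> bounded_family"
    using prob_space_mixture[OF t K E] sets_mixture[OF t K E] by (simp add: bounded_family_def)
next
  show "return borel e \<in> bounded_family"
    using assms by (auto simp: bounded_family_def prob_space_return AE_return)
next
  show "\<exists>\<phi> K. \<phi> \<in> borel_measurable borel \<and> (\<forall>x. 0 \<le> \<phi> x) \<and> (\<forall>x. \<phi> x = 0 \<longrightarrow> x = e) \<and> 0 < K \<and>
        (\<forall>\<kappa>\<in>bounded_family. (\<integral>\<^sup>+x. ennreal (\<phi> x) \<partial>\<kappa>) \<le> ennreal (K * (s * e - s * mean \<kappa>)))"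
  proof (intro exI conjI ballI)
    fix \<kappa> assume k: "\<kappa> \<in> bounded_family"
    then have sets [measurable_cong]: "sets \<kappa> = sets borel" and AE: "AE x in \<kappa>. x \<in> {0..1}"
      by (auto simp: bounded_family_def)
    interpret prob_space \<kappa> using k by (auto simp: bounded_family_def)
    have int: "integrable \<kappa> (\<lambda>x. x)"
      using AE by (intro integrable_const_bound[where B=1]) (auto elim!: AE_mp)
    have nn: "AE x in \<kappa>. 0 \<le> s * (e - x)"
      using AE by eventually_elim (use assms in auto)
    have "(\<integral>\<^sup>+x. ennreal \<bar>s * (e - x)\<bar> \<partial>\<kappa>) = (\<integral>\<^sup>+x. ennreal (s * (e - x)) \<partial>\<kappa>)"
      using nn by (intro nn_integral_cong_AE) (auto elim!: AE_mp)
    also have "\<dots> = ennreal (\<integral>x. s * (e - x) \<partial>\<kappa>)"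
      using int nn by (intro nn_integral_eq_integral) auto
    also have "(\<integral>x. s * (e - x) \<partial>\<kappa>) = 1 * (s * e - s * mean \<kappa>)"
      using int prob_space by (simp add: right_diff_distrib)
    finally show "(\<integral>\<^sup>+x. ennreal \<bar>s * (e - x)\<bar> \<partial>\<kappa>) \<le> ennreal (1 * (s * e - s * mean \<kappa>))" by simp
  qed (use assms in auto)
qed

text \<open>
  Strict convexity of \<open>\<lambda>y. \<bar>y\<bar> powr p\<close>, in the form that only the point of tangency lies on the
  tangent.
\<close>

lemma powr_above_tangent:
  fixes p b y :: real
  assumes p: "1 < p" and b: "0 < b" and y: "y \<noteq> b"
  shows "0 < \<bar>y\<bar> powr p - b powr p - p * b powr (p - 1) * (y - b)"
proof (cases "0 < y")
  case False
  have "b powr p = b powr (p - 1) * b"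
    using b powr_mult_base[of b "p - 1"] by (simp add: mult.commute)
  then have "0 - b powr p - p * b powr (p - 1) * (y - b)
      = (p - 1) * b powr p + p * b powr (p - 1) * (- y)"
    by (simp add: algebra_simps)
  moreover have "0 < (p - 1) * b powr p" using p b by simp
  moreover have "0 \<le> p * b powr (p - 1) * (- y)" using p b False by (intro mult_nonneg_nonneg) auto
  moreover have "0 \<le> \<bar>y\<bar> powr p" by simp
  ultimately show ?thesis by linarith
next
  case True
  have der: "((\<lambda>x. x powr p) has_real_derivative p * x powr (p - 1)) (at x)" if "0 < x" for x
    using that by (auto intro!: derivative_eq_intros)
  show ?thesis
  proof (cases "b < y")
    case True
    obtain z where z: "b < z" "z < y" "y powr p - b powr p = (y - b) * (p * z powr (p - 1))"
      using MVT2[OF True, of "\<lambda>x. x powr p" "\<lambda>x. p * x powr (p - 1)"] der b by auto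
    have less: "p * b powr (p - 1) < p * z powr (p - 1)"
      using p b z by (intro mult_strict_left_mono powr_less_mono2) auto
    then have "(y - b) * (p * b powr (p - 1)) < (y - b) * (p * z powr (p - 1))"
      using True by (intro mult_strict_left_mono[OF less]) auto
    then show ?thesis using z b True by (simp add: mult.commute)
  next
    case False
    then have yb: "y < b" using y by simp
    obtain z where z: "y < z" "z < b" "b powr p - y powr p = (b - y) * (p * z powr (p - 1))"
      using MVT2[OF yb, of "\<lambda>x. x powr p" "\<lambda>x. p * x powr (p - 1)"] der \<open>0 < y\<close> by auto
    have less: "p * z powr (p - 1) < p * b powr (p - 1)"
      using p \<open>0 < y\<close> z by (intro mult_strict_left_mono powr_less_mono2) auto
    then have "(b - y) * (p * z powr (p - 1)) < (b - y) * (p * b powr (p - 1))"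
      using yb by (intro mult_strict_left_mono[OF less]) auto
    moreover have "(b - y) * (p * b powr (p - 1)) = - (p * b powr (p - 1) * (y - b))"
      by (simp add: algebra_simps)
    ultimately show ?thesis using z(3) \<open>0 < y\<close> by simp
  qed
qed

text \<open>
  At the extreme mean the moment bound is attained by a point mass. The gap between
  \<open>\<bar>x\<bar> powr p\<close> and its tangent at that point vanishes only there, and the moment bound turns
  its integral into a multiple of the distance of the mean from the end.
\<close>

lemma extreme_mean_moment_family:
  assumes eps: "0 < \<epsilon>" and Gam: "0 < \<Gamma>" and s: "s = 1 \<or> s = -1"
  shows "extreme_mean (moment_family \<epsilon> \<Gamma>) s (s * \<Gamma> powr (1 / (1 + \<epsilon>)))"
proof -
  define p where "p = 1 + \<epsilon>"
  define b where "b = \<Gamma> powr (1 / p)"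
  have p: "1 < p" using eps by (simp add: p_def)
  have b: "0 < b" using Gam by (simp add: b_def)
  have bp: "b powr p = \<Gamma>" using p Gam by (simp add: b_def powr_powr)
  have ss: "s * (s * b) = b" "\<bar>s\<bar> = 1" using s by auto
  have moment: "integrable \<kappa> (\<lambda>x. \<bar>x\<bar> powr p)" "(\<integral>x. \<bar>x\<bar> powr p \<partial>\<kappa>) \<le> \<Gamma>" "integrable \<kappa> (\<lambda>x. x)"
    if k: "\<kappa> \<in> moment_family \<epsilon> \<Gamma>" for \<kappa>
  proof -
    interpret prob_space \<kappa> using k by (simp add: moment_family_def)
    have [measurable_cong]: "sets \<kappa> = sets borel" and le: "(\<integral>\<^sup>+x. ennreal (\<bar>x\<bar> powr p) \<partial>\<kappa>) \<le> ennreal \<Gamma>"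
      using k by (auto simp: moment_family_def p_def)
    show i: "integrable \<kappa> (\<lambda>x. \<bar>x\<bar> powr p)"
      using le by (intro integrableI_bounded) (auto intro: le_less_trans)
    show "(\<integral>x. \<bar>x\<bar> powr p \<partial>\<kappa>) \<le> \<Gamma>"
      using le i Gam by (subst (asm) nn_integral_eq_integral) auto
    have "integrable \<kappa> (\<lambda>x. 1 + \<bar>x\<bar> powr p)" using i by simp
    then show "integrable \<kappa> (\<lambda>x. x)"
    proof (rule Bochner_Integration.integrable_bound)
      have "\<bar>x\<bar> \<le> 1 + \<bar>x\<bar> powr p" for x :: real
      proof (cases "\<bar>x\<bar> \<le> 1")
        case False
        then have "\<bar>x\<bar> powr 1 \<le> \<bar>x\<bar> powr p" using p by (intro powr_mono) auto
        then show ?thesis using False by simp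
      qed (simp add: add_increasing2)
      then show "AE x in \<kappa>. norm x \<le> norm (1 + \<bar>x\<bar> powr p)" by simp
    qed measurable
  qed
  have "extreme_mean (moment_family \<epsilon> \<Gamma>) s (s * b)"
  proof (rule extreme_mean.intro)
    fix \<kappa> assume "\<kappa> \<in> moment_family \<epsilon> \<Gamma>"
    then show "prob_space \<kappa>" "sets \<kappa> = sets borel" "integrable \<kappa> (\<lambda>x. x)"
      by (auto simp: moment_family_def moment)
  next
    fix t :: real and \<kappa> \<eta>
    assume t: "0 < t" "t < 1" and k: "\<kappa> \<in> moment_family \<epsilon> \<Gamma>" "\<eta> \<in> moment_family \<epsilon> \<Gamma>"
    then have K: "prob_space \<kappa>" "sets \<kappa> = sets borel" and E: "prob_space \<eta>" "sets \<eta> = sets borel"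
      by (auto simp: moment_family_def)
    have "(\<integral>\<^sup>+x. ennreal (\<bar>x\<bar> powr (1 + \<epsilon>)) \<partial>mixture t \<kappa> \<eta>)
        = ennreal t * (\<integral>\<^sup>+x. ennreal (\<bar>x\<bar> powr (1 + \<epsilon>)) \<partial>\<kappa>)
          + ennreal (1 - t) * (\<integral>\<^sup>+x. ennreal (\<bar>x\<bar> powr (1 + \<epsilon>)) \<partial>\<eta>)"
      by (rule nn_integral_mixture[OF t K E]) measurable
    also have "\<dots> \<le> ennreal t * ennreal \<Gamma> + ennreal (1 - t) * ennreal \<Gamma>"
      using k by (intro add_mono mult_left_mono) (auto simp: moment_family_def)
    also have "\<dots> = ennreal \<Gamma>"
      using t Gam by (simp add: algebra_simps flip: ennreal_mult' ennreal_plus)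
    finally show "mixture t \<kappa> \<eta> \<in> moment_family \<epsilon> \<Gamma>"
      using prob_space_mixture[OF t K E] sets_mixture[OF t K E] by (simp add: moment_family_def)
  next
    show "return borel (s * b) \<in> moment_family \<epsilon> \<Gamma>"
      using ss b bp by (simp add: moment_family_def prob_space_return nn_integral_return abs_mult p_def)
  next
    let ?\<phi> = "\<lambda>x. \<bar>x\<bar> powr p - b powr p - p * b powr (p - 1) * (s * x - b)"
    show "\<exists>\<phi> K. \<phi> \<in> borel_measurable borel \<and> (\<forall>x. 0 \<le> \<phi> x) \<and> (\<forall>x. \<phi> x = 0 \<longrightarrow> x = s * b) \<and> 0 < K \<and>
        (\<forall>\<kappa>\<in>moment_family \<epsilon> \<Gamma>. (\<integral>\<^sup>+x. ennreal (\<phi> x) \<partial>\<kappa>) \<le> ennreal (K * (s * (s * b) - s * mean \<kappa>)))"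
    proof (intro exI[of _ ?\<phi>] exI[of _ "p * b powr (p - 1)"] conjI allI impI ballI)
      have abs: "\<bar>s * x\<bar> = \<bar>x\<bar>" for x using ss by (simp add: abs_mult)
      have pos: "0 < ?\<phi> x" if "s * x \<noteq> b" for x
        using powr_above_tangent[OF p b that] by (simp only: abs)
      show nn: "0 \<le> ?\<phi> x" for x
      proof (cases "s * x = b")
        case True
        then have "\<bar>x\<bar> = b" using abs[of x] b by simp
        then show ?thesis using True by simp
      qed (use pos[of x] in simp)
      show "x = s * b" if "?\<phi> x = 0" for x
      proof -
        have "s * x = b" using pos[of x] that by fastforce
        then have "s * (s * x) = s * b" by simp
        then show ?thesis using s by auto
      qed
      show "0 < p * b powr (p - 1)" using p b by simp
      fix \<kappa> assume k: "\<kappa> \<in> moment_family \<epsilon> \<Gamma>"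
      interpret prob_space \<kappa> using k by (simp add: moment_family_def)
      note m = moment[OF k]
      have "(\<integral>\<^sup>+x. ennreal (?\<phi> x) \<partial>\<kappa>) = ennreal (\<integral>x. ?\<phi> x \<partial>\<kappa>)"
        using m nn by (intro nn_integral_eq_integral) auto
      also have "(\<integral>x. ?\<phi> x \<partial>\<kappa>)
          = (\<integral>x. \<bar>x\<bar> powr p \<partial>\<kappa>) - b powr p - p * b powr (p - 1) * (s * mean \<kappa> - b)"
        using m prob_space by simp
      also have "\<dots> \<le> p * b powr (p - 1) * (s * (s * b) - s * mean \<kappa>)"
        using m(2) unfolding ss(1) bp by (simp add: right_diff_distrib)
      finally show "(\<integral>\<^sup>+x. ennreal (?\<phi> x) \<partial>\<kappa>)
          \<le> ennreal (p * b powr (p - 1) * (s * (s * b) - s * mean \<kappa>))"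
        by (simp add: ennreal_leI)
    qed measurable
  qed
  then show ?thesis by (simp add: b_def p_def)
qed

section \<open>Stable policies\<close>

text \<open>
  A report that keeps the interval away from the true mean contradicts coverage, so validity at level
  \<open>\<delta>\<close> makes it rare.
\<close>

lemma non_covering_report_rare:
  assumes \<pi>: "\<pi> \<in> valid_policies P D C" and \<kappa>: "\<kappa> \<in> P" "prob_space \<kappa>" "sets \<kappa> = sets borel"
    and D: "cost_distribution D" and \<delta>: "\<delta> \<in> {0<..<1}"
    and f: "f = lower \<pi> \<or> f = upper \<pi>" and U: "U \<in> sets borel"
    and miss: "\<And>\<omega>. reported f C \<delta> \<omega> \<in> U \<Longrightarrow>
      ereal (mean \<kappa>) \<notin> {reported (lower \<pi>) C \<delta> \<omega> .. reported (upper \<pi>) C \<delta> \<omega>}"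
  shows "measure (joint_law \<kappa> D) {\<omega> \<in> space (joint_law \<kappa> D). reported f C \<delta> \<omega> \<in> U} \<le> \<delta>"
proof -
  let ?J = "joint_law \<kappa> D" and ?m = "ereal (mean \<kappa>)"
  let ?E = "{\<omega> \<in> space ?J. reported f C \<delta> \<omega> \<in> U}"
  interpret D: prob_space D using D by (simp add: cost_distribution_def)
  interpret K: prob_space \<kappa> by fact
  interpret J: prob_space ?J unfolding joint_law_def
    by (intro prob_space_pair prob_space_PiM K.prob_space_axioms D.prob_space_axioms)
  let ?cov = "{\<omega> \<in> space ?J. ?m \<in> {reported (lower \<pi>) C \<delta> \<omega> .. reported (upper \<pi>) C \<delta> \<omega>}}"
  have meas: "lower \<pi> n \<delta> \<in> borel_measurable (\<Pi>\<^sub>M i\<in>{..<n}. borel)"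
      "upper \<pi> n \<delta> \<in> borel_measurable (\<Pi>\<^sub>M i\<in>{..<n}. borel)" for n
    using \<pi> \<delta> by (auto simp: valid_policies_def)
  have E: "?E \<in> sets ?J"
    using f meas U by (intro reported_event(1)[OF \<kappa>(2,3) D]) auto
  have "?cov = {\<omega> \<in> space ?J. reported (lower \<pi>) C \<delta> \<omega> \<in> {..?m}}
      \<inter> {\<omega> \<in> space ?J. reported (upper \<pi>) C \<delta> \<omega> \<in> {?m..}}" by auto
  also have "\<dots> \<in> sets ?J"
    by (intro sets.Int reported_event(1)[OF \<kappa>(2,3) D] meas) simp_all
  finally have cov: "?cov \<in> sets ?J" .
  have "J.prob ?E \<le> J.prob (space ?J - ?cov)"
    using E cov miss by (intro J.finite_measure_mono) auto
  also have "\<dots> = 1 - J.prob ?cov" by (rule J.prob_compl[OF cov])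
  finally have "J.prob ?E \<le> 1 - J.prob ?cov" .
  moreover have "1 - \<delta> \<le> J.prob ?cov"
    using \<pi> \<kappa>(1) \<delta> unfolding valid_policies_def by blast
  ultimately show ?thesis by linarith
qed

text \<open>
  If the limit of an endpoint lies on the wrong side of the mean of some alternative \<open>\<kappa>\<close>, then reports
  near that limit are typical under \<open>\<nu>\<close> but rare under \<open>\<kappa>\<close>, and the information budget applies.
\<close>

lemma separated_limit_budget:
  assumes \<pi>: "\<pi> \<in> valid_policies P D C"
    and \<nu>: "prob_space \<nu>" "sets \<nu> = sets borel"
    and \<kappa>: "\<kappa> \<in> P" "prob_space \<kappa>" "sets \<kappa> = sets borel"
    and KL: "KL \<nu> \<kappa> \<le> ereal c" and D: "cost_distribution D"
    and C: "filterlim C at_top (at_right 0)" and k: "((\<lambda>\<delta>. C \<delta> / ln (1 / \<delta>)) \<longlongrightarrow> k) (at_right 0)"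
    and f: "f = lower \<pi> \<or> f = upper \<pi>" and lim: "tendsto_in_prob (joint_law \<nu> D) (reported f C) l"
    and U: "open U" "l \<in> U"
    and miss: "\<And>\<delta> \<omega>. reported f C \<delta> \<omega> \<in> U \<Longrightarrow>
      ereal (mean \<kappa>) \<notin> {reported (lower \<pi>) C \<delta> \<omega> .. reported (upper \<pi>) C \<delta> \<omega>}"
  shows "mean D \<le> k * c"
proof (rule information_budget[OF \<nu>(1) \<kappa>(2) \<nu>(2) \<kappa>(3) KL D C k])
  show "f n \<delta> \<in> borel_measurable (\<Pi>\<^sub>M i\<in>{..<n}. borel)" if "\<delta> \<in> {0<..<1}" for n \<delta>
    using \<pi> f that by (auto simp: valid_policies_def)
  show "U \<in> sets borel" using U by simp
  show "((\<lambda>\<delta>. measure (joint_law \<nu> D) {\<omega> \<in> space (joint_law \<nu> D). reported f C \<delta> \<omega> \<in> U}) \<longlongrightarrow> 1) (at_right 0)"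
    using lim U by (simp add: tendsto_in_prob_def)
  show "measure (joint_law \<kappa> D) {\<omega> \<in> space (joint_law \<kappa> D). reported f C \<delta> \<omega> \<in> U} \<le> \<delta>"
    if "\<delta> \<in> {0<..<1}" for \<delta>
    using U by (intro non_covering_report_rare[OF \<pi> \<kappa> D that f _ miss]) simp_all
qed

text \<open>
  The same comparison with \<open>\<kappa> = \<nu>\<close>. It serves to locate limits of endpoints for policies that report
  only intervals inside the range of means: reports outside that range belong to empty intervals.
\<close>

lemma limit_outside_rare_set:
  assumes \<pi>: "\<pi> \<in> valid_policies P D C"
    and \<nu>: "\<nu> \<in> P" "prob_space \<nu>" "sets \<nu> = sets borel" and D: "cost_distribution D"
    and f: "f = lower \<pi> \<or> f = upper \<pi>" and lim: "tendsto_in_prob (joint_law \<nu> D) (reported f C) l"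
    and U: "open U"
    and miss: "\<And>\<delta> \<omega>. \<delta> \<in> {0<..<1} \<Longrightarrow> reported f C \<delta> \<omega> \<in> U \<Longrightarrow>
      ereal (mean \<nu>) \<notin> {reported (lower \<pi>) C \<delta> \<omega> .. reported (upper \<pi>) C \<delta> \<omega>}"
  shows "l \<notin> U"
proof
  let ?p = "\<lambda>\<delta>. measure (joint_law \<nu> D) {\<omega> \<in> space (joint_law \<nu> D). reported f C \<delta> \<omega> \<in> U}"
  assume "l \<in> U"
  then have lim1: "(?p \<longlongrightarrow> 1) (at_right 0)"
    using lim U by (simp add: tendsto_in_prob_def)
  have "eventually (\<lambda>\<delta>::real. \<delta> \<in> {0<..<1}) (at_right 0)"
    by (rule eventually_at_right_real) simp
  then have "eventually (\<lambda>\<delta>. ?p \<delta> \<le> \<delta>) (at_right 0)"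
  proof eventually_elim
    case (elim \<delta>)
    show ?case
      using U by (intro non_covering_report_rare[OF \<pi> \<nu> D elim f _ miss[OF elim]]) simp_all
  qed
  then have "(1::real) \<le> 0"
    by (intro tendsto_le[OF _ tendsto_ident_at lim1]) simp_all
  then show False by simp
qed

text \<open>
  Excluding an alternative with divergence \<open>c\<close> requires \<open>cbar \<le> k * c\<close>. For \<open>k = 0\<close> this never holds, so
  no mean with a finite divergence can be excluded. For \<open>k > 0\<close>, if the limit of an endpoint lay
  strictly inside the interval between the two solutions, some mean beyond that limit would belong to an
  alternative with \<open>c < cbar / k\<close>.
\<close>

theorem theorem5:
  fixes P :: "real measure set" and \<epsilon> \<Gamma> mu_lo mu_hi :: real
    and \<nu> D :: "real measure" and cbar :: real
    and C :: "real \<Rightarrow> real" and \<pi> :: ci_policy and mL mR :: ereal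
  assumes "\<epsilon> > 0" and "\<Gamma> > 0"
    and "(P = bounded_family \<and> mu_lo = 0 \<and> mu_hi = 1) \<or>
         (P = moment_family \<epsilon> \<Gamma> \<and>
          mu_lo = - (\<Gamma> powr (1 / (1 + \<epsilon>))) \<and> mu_hi = \<Gamma> powr (1 / (1 + \<epsilon>)))"
    and "\<nu> \<in> P"
    and "cost_distribution D" and "cbar = mean D" and "0 < cbar"
    and "filterlim C at_top (at_right 0)"
    and "\<pi> \<in> valid_policies P D C"
    and "stable_at \<nu> D C \<pi> mL mR"
  shows "(((\<lambda>\<delta>. C \<delta> / ln (1 / \<delta>)) \<longlongrightarrow> 0) (at_right 0) \<longrightarrow>
            reports_within \<pi> mu_lo mu_hi \<longrightarrow>
            mR - mL = ereal (mu_hi - mu_lo) \<and>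
            tendsto_in_prob (joint_law \<nu> D) (reported (lower \<pi>) C) (ereal mu_lo) \<and>
            tendsto_in_prob (joint_law \<nu> D) (reported (upper \<pi>) C) (ereal mu_hi)) \<and>
         (\<forall>k>0. ((\<lambda>\<delta>. C \<delta> / ln (1 / \<delta>)) \<longlongrightarrow> k) (at_right 0) \<longrightarrow>
            (mu_lo < mean \<nu> \<longrightarrow> (\<exists>!l. l < mean \<nu> \<and> KL_inf \<nu> P l = ereal (cbar / k))) \<and>
            (mean \<nu> < mu_hi \<longrightarrow> (\<exists>!r. r > mean \<nu> \<and> KL_inf \<nu> P r = ereal (cbar / k))) \<and>
            (\<forall>l r. l < mean \<nu> \<longrightarrow> KL_inf \<nu> P l = ereal (cbar / k) \<longrightarrow>
                   r > mean \<nu> \<longrightarrow> KL_inf \<nu> P r = ereal (cbar / k) \<longrightarrow>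
                   mR - mL \<ge> ereal (r - l)))"
proof -
  note eps = assms(1) and Gam = assms(2) and \<nu> = assms(4) and D = assms(5) and cbar = assms(6,7)
    and C = assms(8) and \<pi> = assms(9)
  have means: "mL \<le> ereal (mean \<nu>)" "ereal (mean \<nu>) \<le> mR"
    and limL: "tendsto_in_prob (joint_law \<nu> D) (reported (lower \<pi>) C) mL"
    and limR: "tendsto_in_prob (joint_law \<nu> D) (reported (upper \<pi>) C) mR"
    using assms(10) by (auto simp: stable_at_def)
  have "extreme_mean P 1 mu_hi \<and> extreme_mean P (-1) mu_lo"
    using assms(3) extreme_mean_bounded_family[of 1 1] extreme_mean_bounded_family[of "-1" 0]
      extreme_mean_moment_family[OF eps Gam, of 1] extreme_mean_moment_family[OF eps Gam, of "-1"]
    by auto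
  then interpret hi: extreme_mean P 1 mu_hi + lo: extreme_mean P "-1" mu_lo by auto
  note prob = hi.prob and sets = hi.sets
  have right: "KL_inf \<nu> P r = hi.divergence_beyond \<nu> r" if "mean \<nu> < r" for r
    using that by (simp add: KL_inf_def hi.divergence_beyond_def)
  have left: "KL_inf \<nu> P l = lo.divergence_beyond \<nu> (- l)" if "l < mean \<nu>" for l
    using that by (simp add: KL_inf_def lo.divergence_beyond_def)
  have budget: "cbar \<le> k * c"
    if k: "((\<lambda>\<delta>. C \<delta> / ln (1 / \<delta>)) \<longlongrightarrow> k) (at_right 0)"
      and \<kappa>: "\<kappa> \<in> P" "KL \<nu> \<kappa> \<le> ereal c"
      and excluded: "mR < ereal (mean \<kappa>) \<or> ereal (mean \<kappa>) < mL" for k c \<kappa>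
    using excluded
  proof
    assume "mR < ereal (mean \<kappa>)"
    then show ?thesis unfolding cbar(1)
      by (intro separated_limit_budget[OF \<pi> prob[OF \<nu>] sets[OF \<nu>] \<kappa>(1) prob[OF \<kappa>(1)]
            sets[OF \<kappa>(1)] \<kappa>(2) D C k _ limR, of "{..<ereal (mean \<kappa>)}"]) auto
  next
    assume "ereal (mean \<kappa>) < mL"
    then show ?thesis unfolding cbar(1)
      by (intro separated_limit_budget[OF \<pi> prob[OF \<nu>] sets[OF \<nu>] \<kappa>(1) prob[OF \<kappa>(1)]
            sets[OF \<kappa>(1)] \<kappa>(2) D C k _ limL, of "{ereal (mean \<kappa>)<..}"]) auto
  qed
  show ?thesis
  proof (intro conjI impI allI)
    assume k0: "((\<lambda>\<delta>. C \<delta> / ln (1 / \<delta>)) \<longlongrightarrow> 0) (at_right 0)" and within: "reports_within \<pi> mu_lo mu_hi"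
    have sub: "{reported (lower \<pi>) C \<delta> \<omega> .. reported (upper \<pi>) C \<delta> \<omega>} \<subseteq> {ereal mu_lo..ereal mu_hi}"
      if "\<delta> \<in> {0<..<1}" for \<delta> \<omega>
      using within that by (auto simp: reports_within_def reported_def Let_def)
    have "mR \<notin> {ereal mu_hi<..}"
    proof (rule limit_outside_rare_set[OF \<pi> \<nu> prob[OF \<nu>] sets[OF \<nu>] D _ limR])
      fix \<delta> \<omega> assume "\<delta> \<in> {0<..<1}" "reported (upper \<pi>) C \<delta> \<omega> \<in> {ereal mu_hi<..}"
      then show "ereal (mean \<nu>) \<notin> {reported (lower \<pi>) C \<delta> \<omega> .. reported (upper \<pi>) C \<delta> \<omega>}"
        using sub[of \<delta> \<omega>] by (simp add: not_le) (metis order_trans not_le)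
    qed auto
    moreover have "ereal mu_hi \<le> mR"
    proof (rule ccontr)
      assume "\<not> ?thesis"
      then have lt: "mR < ereal mu_hi" by simp
      have m: "1 * mean \<nu> < 1 * mu_hi" using le_less_trans[OF means(2) lt] by simp
      obtain x where x: "mR < ereal x" "ereal x < ereal mu_hi" using ereal_dense2[OF lt] by blast
      then obtain \<kappa> c where \<kappa>: "\<kappa> \<in> P" "x < 1 * mean \<kappa>" "KL \<nu> \<kappa> \<le> ereal c"
        using hi.finite_divergence_beyond[OF \<nu> m, of x] by auto
      have "mR < ereal (mean \<kappa>)" using less_trans[OF x(1)] \<kappa>(2) by simp
      then show False using budget[OF k0 \<kappa>(1,3)] cbar(2) by simp
    qed
    ultimately have mR: "mR = ereal mu_hi" by simp
    have "mL \<notin> {..<ereal mu_lo}"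
    proof (rule limit_outside_rare_set[OF \<pi> \<nu> prob[OF \<nu>] sets[OF \<nu>] D _ limL])
      fix \<delta> \<omega> assume "\<delta> \<in> {0<..<1}" "reported (lower \<pi>) C \<delta> \<omega> \<in> {..<ereal mu_lo}"
      then show "ereal (mean \<nu>) \<notin> {reported (lower \<pi>) C \<delta> \<omega> .. reported (upper \<pi>) C \<delta> \<omega>}"
        using sub[of \<delta> \<omega>] by (simp add: not_le) (metis order_trans not_le)
    qed auto
    moreover have "mL \<le> ereal mu_lo"
    proof (rule ccontr)
      assume "\<not> ?thesis"
      then have lt: "ereal mu_lo < mL" by simp
      have m: "-1 * mean \<nu> < -1 * mu_lo" using less_le_trans[OF lt means(1)] by simp
      obtain x where x: "ereal mu_lo < ereal x" "ereal x < mL" using ereal_dense2[OF lt] by blast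
      then obtain \<kappa> c where \<kappa>: "\<kappa> \<in> P" "- x < -1 * mean \<kappa>" "KL \<nu> \<kappa> \<le> ereal c"
        using lo.finite_divergence_beyond[OF \<nu> m, of "- x"] by auto
      have "ereal (mean \<kappa>) < mL" using less_trans[OF _ x(2)] \<kappa>(2) by simp
      then show False using budget[OF k0 \<kappa>(1,3)] cbar(2) by simp
    qed
    ultimately have mL: "mL = ereal mu_lo" by simp
    show "mR - mL = ereal (mu_hi - mu_lo)" by (simp add: mR mL)
    show "tendsto_in_prob (joint_law \<nu> D) (reported (lower \<pi>) C) (ereal mu_lo)" using limL mL by simp
    show "tendsto_in_prob (joint_law \<nu> D) (reported (upper \<pi>) C) (ereal mu_hi)" using limR mR by simp
  next
    fix k :: real assume k: "0 < k" and "mean \<nu> < mu_hi"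
    then have "\<exists>!r. 1 * mean \<nu> < r \<and> hi.divergence_beyond \<nu> r = ereal (cbar / k)"
      using cbar(2) by (intro hi.ex1_divergence_beyond_eq[OF \<nu>]) auto
    moreover have "1 * mean \<nu> < r \<and> hi.divergence_beyond \<nu> r = ereal (cbar / k)
        \<longleftrightarrow> r > mean \<nu> \<and> KL_inf \<nu> P r = ereal (cbar / k)" for r
      using right by auto
    ultimately show "\<exists>!r. r > mean \<nu> \<and> KL_inf \<nu> P r = ereal (cbar / k)" by simp
  next
    fix k :: real assume k: "0 < k" and "mu_lo < mean \<nu>"
    then have "\<exists>!r. -1 * mean \<nu> < r \<and> lo.divergence_beyond \<nu> r = ereal (cbar / k)"
      using cbar(2) by (intro lo.ex1_divergence_beyond_eq[OF \<nu>]) auto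
    then obtain r where r: "-1 * mean \<nu> < r" "lo.divergence_beyond \<nu> r = ereal (cbar / k)"
      and uniq: "\<And>r'. -1 * mean \<nu> < r' \<Longrightarrow> lo.divergence_beyond \<nu> r' = ereal (cbar / k) \<Longrightarrow> r' = r"
      by blast
    show "\<exists>!l. l < mean \<nu> \<and> KL_inf \<nu> P l = ereal (cbar / k)"
    proof (rule ex1I)
      show "- r < mean \<nu> \<and> KL_inf \<nu> P (- r) = ereal (cbar / k)"
        using r left[of "- r"] by simp
      fix l assume l: "l < mean \<nu> \<and> KL_inf \<nu> P l = ereal (cbar / k)"
      then have "- l = r" using left[of l] by (intro uniq) auto
      then show "l = - r" by simp
    qed
  next
    fix k l r :: real
    assume k: "0 < k" "((\<lambda>\<delta>. C \<delta> / ln (1 / \<delta>)) \<longlongrightarrow> k) (at_right 0)"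
      and l: "l < mean \<nu>" "KL_inf \<nu> P l = ereal (cbar / k)"
      and r: "r > mean \<nu>" "KL_inf \<nu> P r = ereal (cbar / k)"
    have v: "0 < cbar / k" using k(1) cbar(2) by simp
    have too_cheap: False if "cbar \<le> k * c" "c < cbar / k" for c
      using that k(1) by (simp add: pos_less_divide_eq mult.commute)
    have "ereal r \<le> mR"
    proof (rule ccontr)
      assume "\<not> ?thesis"
      then obtain x where x: "mR < ereal x" "ereal x < ereal r" using ereal_dense2 by (meson not_le)
      then have "ereal (mean \<nu>) < ereal x" using means(2) by (meson le_less_trans)
      then obtain \<kappa> c where \<kappa>: "\<kappa> \<in> P" "x \<le> 1 * mean \<kappa>" "KL \<nu> \<kappa> \<le> ereal c" "c < cbar / k"
        using hi.cheaper_before[OF \<nu> v, of r x] r right[OF r(1)] x by auto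
      have "mR < ereal (mean \<kappa>)" using less_le_trans[OF x(1)] \<kappa>(2) by simp
      then show False using budget[OF k(2) \<kappa>(1,3)] too_cheap[OF _ \<kappa>(4)] by blast
    qed
    moreover have "mL \<le> ereal l"
    proof (rule ccontr)
      assume "\<not> ?thesis"
      then obtain x where x: "ereal l < ereal x" "ereal x < mL" using ereal_dense2 by (meson not_le)
      then have "ereal x < ereal (mean \<nu>)" using means(1) by (meson less_le_trans)
      then obtain \<kappa> c where \<kappa>: "\<kappa> \<in> P" "- x \<le> -1 * mean \<kappa>" "KL \<nu> \<kappa> \<le> ereal c" "c < cbar / k"
        using lo.cheaper_before[OF \<nu> v, of "- l" "- x"] l left[OF l(1)] x by auto
      have "ereal (mean \<kappa>) < mL" using le_less_trans[OF _ x(2)] \<kappa>(2) by simp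
      then show False using budget[OF k(2) \<kappa>(1,3)] too_cheap[OF _ \<kappa>(4)] by blast
    qed
    ultimately have "ereal r - ereal l \<le> mR - mL" by (rule ereal_minus_mono)
    then show "mR - mL \<ge> ereal (r - l)" by simp
  qed
qed

end
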